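(* For every fixed $\varepsilon\in(0,1]$, \textsc{CP-Opt} is $\left(\frac{1}{2}+\frac{1}{2(\varepsilon n+1)}\right)$-approximable in polynomial time, i.e., there is a polynomial-time algorithm returning a feasible solution whose weight is at least $\left(\frac{1}{2}+\frac{1}{2(\varepsilon n+1)}\right)$ times the maximum weight of a feasible solution, where $n$ is the total number of slots. This holds whether word reuse is allowed or not.
   Context: A crossword instance consists of a dictionary $\mathcal{D}$ of $m$ words over an alphabet $\mathcal{L}$ of constant size, and a grid of cells containing $n$ slots; a slot is a set of consecutive cells in a row (horizontal) or column (vertical). Horizontal slots are pairwise disjoint, vertical slots are pairwise disjoint; a cell in two slots is shared. A feasible solution assigns to each slot $S$ either a word of $\mathcal{D}$ of length exactly $|S|$ or nothing; horizontal words left to right, vertical words top to bottom; intersecting filled slots must agree on their shared cell. With word reuse a word may fill several slots; without, each word fills at most one slot. Given $w:\mathcal{L}\to\mathbb{N}$, the weight of a solution is the sum of the weights of the letters placed in the grid, each cell counted once. \textsc{CP-Opt}: find a feasible solution of maximum weight. The input size is polynomial in $n+m$. *)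

theory Defs
  imports Complex_Main "HOL-Computational_Algebra.Polynomial"
begin

section \<open>Crossword instances and solutions\<close>

datatype orientation = Horizontal | Vertical

text \<open>A slot is given by its orientation, its topmost/leftmost cell and its number of cells.
  Rows are numbered from top to bottom and columns from left to right, starting from 0.\<close>

record slot =
  orient :: orientation
  row :: nat
  col :: nat
  len :: nat

fun cell_at :: "slot \<Rightarrow> nat \<Rightarrow> nat \<times> nat" where
  "cell_at s k = (case orient s of
      Horizontal \<Rightarrow> (row s, col s + k)
    | Vertical \<Rightarrow> (row s + k, col s))"

definition cells :: "slot \<Rightarrow> (nat \<times> nat) set" where
  "cells s = cell_at s ` {..<len s}"

text \<open>The alphabet with \<open>A\<close> letters is \<open>{..<A}\<close>; the list \<open>letter_weight\<close> tabulates the weight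
  function on it.\<close>

type_synonym word = "nat list"

record crossword =
  height :: nat
  width :: nat
  slots :: "slot list"
  dict :: "word list"
  letter_weight :: "nat list"

abbreviation num_slots :: "crossword \<Rightarrow> nat" where
  "num_slots I \<equiv> length (slots I)"

definition crossword_over :: "nat \<Rightarrow> crossword \<Rightarrow> bool" where
  "crossword_over A I \<longleftrightarrow>
     (\<forall>s \<in> set (slots I). len s > 0 \<and> cells s \<subseteq> {..<height I} \<times> {..<width I}) \<and>
     (\<forall>i < num_slots I. \<forall>j < num_slots I.
        i \<noteq> j \<and> orient (slots I ! i) = orient (slots I ! j) \<longrightarrow>
        cells (slots I ! i) \<inter> cells (slots I ! j) = {}) \<and>
     distinct (dict I) \<and>
     (\<forall>u \<in> set (dict I). set u \<subseteq> {..<A}) \<and>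
     length (letter_weight I) = A"

text \<open>The \<open>i\<close>-th entry of a solution is the word assigned to the \<open>i\<close>-th slot, if any.\<close>

type_synonym solution = "word option list"

text \<open>The letters written by the filled slots, with their positions.\<close>

definition placed :: "crossword \<Rightarrow> solution \<Rightarrow> ((nat \<times> nat) \<times> nat) set" where
  "placed I S = {(cell_at (slots I ! i) k, u ! k) | i u k.
     i < num_slots I \<and> S ! i = Some u \<and> k < len (slots I ! i)}"

definition feasible :: "bool \<Rightarrow> crossword \<Rightarrow> solution \<Rightarrow> bool" where
  "feasible reuse I S \<longleftrightarrow>
     length S = num_slots I \<and>
     (\<forall>i < num_slots I. \<forall>u. S ! i = Some u \<longrightarrow> u \<in> set (dict I) \<and> length u = len (slots I ! i)) \<and>
     (\<forall>c a b. (c, a) \<in> placed I S \<and> (c, b) \<in> placed I S \<longrightarrow> a = b) \<and>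
     (\<not> reuse \<longrightarrow>
        (\<forall>i < num_slots I. \<forall>j < num_slots I. \<forall>u. S ! i = Some u \<and> S ! j = Some u \<longrightarrow> i = j))"

text \<open>In a feasible solution, a cell occurs in at most one pair of \<open>placed I S\<close>, even if it is
  shared by two filled slots; so every cell is counted once.\<close>

definition weight :: "crossword \<Rightarrow> solution \<Rightarrow> nat" where
  "weight I S = (\<Sum>(c, a) \<in> placed I S. letter_weight I ! a)"

definition opt_weight :: "bool \<Rightarrow> crossword \<Rightarrow> nat" where
  "opt_weight reuse I = Max (weight I ` {S. feasible reuse I S})"

text \<open>The maximum is taken over a finite nonempty set.\<close>

lemma finite_feasible: "finite {S. feasible reuse I S}"
proof (rule finite_subset)
  show "{S. feasible reuse I S} \<subseteq>
      {S. set S \<subseteq> insert None (Some ` set (dict I)) \<and> length S = num_slots I}"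
  proof (intro subsetI CollectI conjI)
    fix S x assume S: "S \<in> {S. feasible reuse I S}" and "x \<in> set S"
    then obtain i where "i < num_slots I" "x = S ! i"
      by (auto simp: feasible_def in_set_conv_nth)
    with S show "x \<in> insert None (Some ` set (dict I))"
      by (cases x) (auto simp: feasible_def)
  qed (simp add: feasible_def)
  show "finite {S. set S \<subseteq> insert None (Some ` set (dict I)) \<and> length S = num_slots I}"
    by (rule finite_lists_length_eq) simp
qed

lemma feasible_empty: "feasible reuse I (replicate (num_slots I) None)"
  by (auto simp: feasible_def placed_def)

section \<open>Computations\<close>

text \<open>
  Programs are those of a while language on binary trees with a single program variable, as in
  Jones, \<^emph>\<open>Computability and Complexity: From a Programming Perspective\<close>. If trees are
  represented by pointers to possibly shared cons cells, every rule below performs a bounded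
  number of machine operations besides those of its premises. Hence running in polynomially many
  steps here is the same as running in polynomial time on a Turing machine.
\<close>

datatype tree = Atom | Cons tree tree

fun left :: "tree \<Rightarrow> tree" where
  "left Atom = Atom"
| "left (Cons x y) = x"

fun right :: "tree \<Rightarrow> tree" where
  "right Atom = Atom"
| "right (Cons x y) = y"

datatype prog =
    PId
  | PAtom
  | PLeft
  | PRight
  | PCons prog prog
  | PSeq prog prog
  | PIf prog prog prog
  | PWhile prog prog

text \<open>\<open>exec p x t y\<close>: on input \<open>x\<close>, program \<open>p\<close> halts after \<open>t\<close> steps with output \<open>y\<close>.
  In tests, \<open>Atom\<close> stands for false and every other tree for true.\<close>

inductive exec :: "prog \<Rightarrow> tree \<Rightarrow> nat \<Rightarrow> tree \<Rightarrow> bool" where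
  Id: "exec PId x 1 x"
| Atom: "exec PAtom x 1 Atom"
| Left: "exec PLeft x 1 (left x)"
| Right: "exec PRight x 1 (right x)"
| Cons: "exec p x s y \<Longrightarrow> exec q x t z \<Longrightarrow> exec (PCons p q) x (s + t + 1) (Cons y z)"
| Seq: "exec p x s y \<Longrightarrow> exec q y t z \<Longrightarrow> exec (PSeq p q) x (s + t + 1) z"
| If_True: "exec b x s c \<Longrightarrow> c \<noteq> Atom \<Longrightarrow> exec p x t y \<Longrightarrow> exec (PIf b p q) x (s + t + 1) y"
| If_False: "exec b x s Atom \<Longrightarrow> exec q x t y \<Longrightarrow> exec (PIf b p q) x (s + t + 1) y"
| While_True: "exec b x s c \<Longrightarrow> c \<noteq> Atom \<Longrightarrow> exec p x t y \<Longrightarrow> exec (PWhile b p) y r z \<Longrightarrow>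
    exec (PWhile b p) x (s + t + r + 1) z"
| While_False: "exec b x s Atom \<Longrightarrow> exec (PWhile b p) x (s + 1) x"

lemma exec_deterministic: "exec p x t y \<Longrightarrow> exec p x t' y' \<Longrightarrow> t = t' \<and> y = y'"
proof (induction arbitrary: t' y' rule: exec.induct)
  case (While_True b x s c p t y r z)
  from While_True.prems show ?case
    by (cases rule: exec.cases) (use While_True in blast)+
next
  case (While_False b x s p)
  from While_False.prems show ?case
    by (cases rule: exec.cases) (use While_False in blast)+
qed (erule exec.cases; blast)+

section \<open>Encoding of instances and solutions\<close>

text \<open>Numbers, including the coordinates and the weights, are written in binary, with the least
  significant bit first.\<close>

fun enc_nat :: "nat \<Rightarrow> tree" where
  "enc_nat n = (if n = 0 then Atom
     else Cons (if odd n then Cons Atom Atom else Atom) (enc_nat (n div 2)))"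

declare enc_nat.simps [simp del]

definition enc_list :: "('a \<Rightarrow> tree) \<Rightarrow> 'a list \<Rightarrow> tree" where
  "enc_list f xs = foldr (\<lambda>x. Cons (f x)) xs Atom"

fun enc_option :: "('a \<Rightarrow> tree) \<Rightarrow> 'a option \<Rightarrow> tree" where
  "enc_option f None = Atom"
| "enc_option f (Some x) = Cons (f x) Atom"

fun enc_orientation :: "orientation \<Rightarrow> tree" where
  "enc_orientation Horizontal = Atom"
| "enc_orientation Vertical = Cons Atom Atom"

definition enc_slot :: "slot \<Rightarrow> tree" where
  "enc_slot s = Cons (enc_orientation (orient s))
     (Cons (enc_nat (row s)) (Cons (enc_nat (col s)) (enc_nat (len s))))"

definition enc_crossword :: "crossword \<Rightarrow> tree" where
  "enc_crossword I =
     Cons (enc_nat (height I)) (Cons (enc_nat (width I))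
       (Cons (enc_list enc_slot (slots I))
         (Cons (enc_list (enc_list enc_nat) (dict I))
           (enc_list enc_nat (letter_weight I)))))"

definition enc_solution :: "solution \<Rightarrow> tree" where
  "enc_solution S = enc_list (enc_option (enc_list enc_nat)) S"

lemma inj_enc_nat: "inj enc_nat"
proof (rule injI)
  show "enc_nat m = enc_nat n \<Longrightarrow> m = n" for m n
  proof (induction m arbitrary: n rule: less_induct)
    case (less m)
    show ?case
    proof (cases "m = 0 \<or> n = 0")
      case True
      with less.prems show ?thesis
        by (auto simp: enc_nat.simps[of m] enc_nat.simps[of n] split: if_splits)
    next
      case False
      with less.prems have "odd m = odd n" "enc_nat (m div 2) = enc_nat (n div 2)"
        by (auto simp: enc_nat.simps[of m] enc_nat.simps[of n] split: if_splits)
      moreover from this False less.IH have "m div 2 = n div 2" by simp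
      ultimately show ?thesis by (metis even_two_times_div_two odd_two_times_div_two_succ)
    qed
  qed
qed

lemma inj_enc_list: assumes "inj f" shows "inj (enc_list f)"
proof (rule injI)
  show "enc_list f xs = enc_list f ys \<Longrightarrow> xs = ys" for xs ys
  proof (induction xs arbitrary: ys)
    case Nil
    then show ?case by (cases ys) (auto simp: enc_list_def)
  next
    case (Cons x xs)
    then show ?case
      by (cases ys) (auto simp: enc_list_def inj_eq[OF assms])
  qed
qed

lemma inj_enc_option: assumes "inj f" shows "inj (enc_option f)"
proof (rule injI)
  show "enc_option f x = enc_option f y \<Longrightarrow> x = y" for x y
    by (cases x; cases y) (auto simp: inj_eq[OF assms])
qed

lemma inj_enc_slot: "inj enc_slot"
proof (rule injI)
  show "enc_slot s = enc_slot s' \<Longrightarrow> s = s'" for s s'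
    by (cases "orient s"; cases "orient s'") (auto simp: enc_slot_def inj_eq[OF inj_enc_nat])
qed

lemma inj_enc_crossword: "inj enc_crossword"
  by (rule injI) (simp add: enc_crossword_def inj_eq[OF inj_enc_nat]
    inj_eq[OF inj_enc_list[OF inj_enc_slot]] inj_eq[OF inj_enc_list[OF inj_enc_nat]]
    inj_eq[OF inj_enc_list[OF inj_enc_list[OF inj_enc_nat]]])

lemma inj_enc_solution: "inj enc_solution"
  unfolding enc_solution_def
  by (intro inj_enc_list inj_enc_option inj_enc_nat)

section \<open>Polynomial-time approximability\<close>

text \<open>The size of the input is the number of cons cells of its encoding as a tree. The guaranteed
  ratio may depend on the number of slots; the alphabet is fixed, so the program may depend
  on it.\<close>

definition poly_time_approximable :: "nat \<Rightarrow> bool \<Rightarrow> (nat \<Rightarrow> real) \<Rightarrow> bool" where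
  "poly_time_approximable A reuse \<rho> \<longleftrightarrow>
     (\<exists>(P :: prog) (q :: nat poly). \<forall>I. crossword_over A I \<longrightarrow>
        (\<exists>t S. exec P (enc_crossword I) t (enc_solution S) \<and>
               t \<le> poly q (size (enc_crossword I)) \<and>
               feasible reuse I S \<and>
               real (weight I S) \<ge> \<rho> (num_slots I) * real (opt_weight reuse I)))"

end

theory Submission
  imports Defs
begin

text \<open>
  Fix an optimal solution of weight \<open>W\<close>. For one of the two orientations \<open>d\<close>, the cells that are
  covered only by words of the other orientation have total weight at most \<open>W / 2\<close>. Slots of the
  same orientation are disjoint, so this weight is additive over these words, and the \<open>k\<close> heaviest
  of them retain at least a fraction \<open>k / n\<close> of it. The algorithm tries all sets \<open>P\<close> of at most
  \<open>k\<close> entries (a slot with a word) and extends each of them by entries of orientation \<open>d\<close>. As the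
  slots of orientation \<open>d\<close> do not interact, the extension is a maximum weight bipartite matching
  between slots and words, or between slots and pairs of a slot and a word if words can be reused.

  It suffices to solve the matching problem up to an error of \<open>W / (k * n)\<close>. This is done by an
  auction: while some unmatched slot has a profitable word, it takes the most profitable one, and
  the price of that word rises by a fixed increment, namely a \<open>k * n\<^sup>2\<close>-th of a lower
  bound \<open>G \<le> W\<close> that exceeds all gains. Hence there are polynomially many bids, and each of the
  at most \<open>n\<close> matched slots loses at most one increment compared with the dual solution given by
  the final prices. With \<open>k \<ge> 4 / \<epsilon>\<close> the ratio follows.

  Polynomial running time is shown with a class \<open>ptime\<close> of functions on encodable types that is
  closed under composition and under folding over a list, provided that a step increases the
  size of the state by an amount that is bounded independently of the state.
\<close>

section \<open>Functions computable in polynomial time\<close>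

text \<open>Injectivity lets equality on every such type be decided by comparing trees, as
  \<open>ptime_eq\<close> does.\<close>

class enc =
  fixes encode :: "'a \<Rightarrow> tree"
  assumes encode_inject: "encode x = encode y \<longleftrightarrow> x = y"

instantiation tree :: enc
begin
definition encode_tree :: "tree \<Rightarrow> tree" where "encode_tree t = t"
instance by standard (simp add: encode_tree_def)
end

instantiation nat :: enc
begin
definition encode_nat :: "nat \<Rightarrow> tree" where "encode_nat = enc_nat"
instance by standard (simp add: encode_nat_def inj_eq[OF inj_enc_nat])
end

instantiation bool :: enc
begin
definition encode_bool :: "bool \<Rightarrow> tree" where "encode_bool b = (if b then Cons Atom Atom else Atom)"
instance by standard (simp add: encode_bool_def)
end

instantiation orientation :: enc
begin
definition encode_orientation :: "orientation \<Rightarrow> tree" where "encode_orientation = enc_orientation"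
instance
proof
  show "encode x = encode y \<longleftrightarrow> x = y" for x y :: orientation
    by (cases x; cases y) (simp_all add: encode_orientation_def)
qed
end

instantiation prod :: (enc, enc) enc
begin
definition encode_prod :: "'a \<times> 'b \<Rightarrow> tree" where "encode_prod p = Cons (encode (fst p)) (encode (snd p))"
instance by standard (simp add: encode_prod_def encode_inject prod_eq_iff)
end

instantiation list :: (enc) enc
begin
definition encode_list :: "'a list \<Rightarrow> tree" where "encode_list = enc_list encode"
instance
  by standard (simp add: encode_list_def inj_eq[OF inj_enc_list] encode_inject inj_def)
end

instantiation option :: (enc) enc
begin
definition encode_option :: "'a option \<Rightarrow> tree" where "encode_option = enc_option encode"
instance
  by standard (simp add: encode_option_def inj_eq[OF inj_enc_option] encode_inject inj_def)
end

lemma encode_simps [simp]: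
  "encode (t :: tree) = t"
  "encode True = Cons Atom Atom"
  "encode False = Atom"
  "encode (a, b) = Cons (encode a) (encode b)"
  "encode ([] :: 'a::enc list) = Atom"
  "encode (x # xs) = Cons (encode x) (encode xs)"
  "encode (None :: 'a::enc option) = Atom"
  "encode (Some x) = Cons (encode x) Atom"
  "encode Horizontal = Atom"
  "encode Vertical = Cons Atom Atom"
  by (simp_all add: encode_tree_def encode_bool_def encode_prod_def encode_list_def
      encode_option_def enc_list_def encode_orientation_def)

abbreviation tsize :: "'a::enc \<Rightarrow> nat" where
  "tsize x \<equiv> size (encode x)"

lemma tsize_simps [simp]:
  "tsize (p :: 'a::enc \<times> 'b::enc) = tsize (fst p) + tsize (snd p) + 1"
  by (simp add: encode_prod_def)

lemma tsize_append: "tsize (xs @ ys) = tsize xs + tsize ys"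
  by (induction xs) auto

lemma tsize_member: "x \<in> set xs \<Longrightarrow> tsize x < tsize xs"
  by (induction xs) auto

lemma length_le_tsize: "length xs \<le> tsize xs"
  by (induction xs) auto

text \<open>Coefficients are natural numbers, so none is negative; this is what allows bounds to be
  composed.\<close>

lemma poly_mono_nat: "m \<le> n \<Longrightarrow> poly (q :: nat poly) m \<le> poly q n"
  by (induction q) (auto intro: add_mono mult_mono)

text \<open>The output size must be bounded separately: since equal subtrees are shared, a program can
  output an exponentially large tree in polynomially many steps.\<close>

definition ptime :: "('a::enc \<Rightarrow> 'b::enc) \<Rightarrow> bool" where
  "ptime f \<longleftrightarrow> (\<exists>p q. \<forall>x. (\<exists>t. exec p (encode x) t (encode (f x)) \<and> t \<le> poly q (tsize x)) \<and>
     tsize (f x) \<le> poly q (tsize x))"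

lemma ptimeI:
  assumes "\<And>x. \<exists>t. exec p (encode x) t (encode (f x)) \<and> t \<le> poly q (tsize x)"
    and "\<And>x. tsize (f x) \<le> poly r (tsize x)"
  shows "ptime f"
  unfolding ptime_def
proof (intro exI[of _ p] exI[of _ "q + r"] allI conjI)
  fix x
  from assms(1)[of x] show "\<exists>t. exec p (encode x) t (encode (f x)) \<and> t \<le> poly (q + r) (tsize x)"
    by (metis poly_add trans_le_add1)
  from assms(2)[of x] show "tsize (f x) \<le> poly (q + r) (tsize x)" by simp
qed

lemma ptimeE:
  assumes "ptime f"
  obtains p q where "\<And>x. \<exists>t. exec p (encode x) t (encode (f x)) \<and> t \<le> poly q (tsize x)"
    and "\<And>x. tsize (f x) \<le> poly q (tsize x)"
  using assms unfolding ptime_def by blast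

lemma ptime_tsize:
  assumes "ptime f" obtains q where "\<And>x. tsize (f x) \<le> poly q (tsize x)"
  using assms by (rule ptimeE) (rule that)

section \<open>Closure under composition, constructors and branching\<close>

named_theorems ptime_intros

text \<open>The identity program performs any change of type that keeps the tree; this covers
  \<open>encode\<close> itself and the passage from a number to its bits.\<close>

lemma ptime_recode:
  assumes "\<And>x. encode (f x) = encode x" shows "ptime f"
proof (rule ptimeI[where p = PId and q = 1 and r = "[:0, 1:]"])
  show "\<exists>t. exec PId (encode x) t (encode (f x)) \<and> t \<le> poly 1 (tsize x)" for x
    using assms exec.Id by auto
qed (simp add: assms)

lemma ptime_id [ptime_intros]: "ptime (\<lambda>x. x)"
  by (rule ptime_recode) simp

text \<open>The time for \<open>g\<close> is measured in the size of \<open>f x\<close>; the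
  separate output bound for \<open>f\<close> turns it into a bound in the size of
  \<open>x\<close>.\<close>

lemma ptime_comp:
  assumes "ptime g" "ptime f" shows "ptime (\<lambda>x. g (f x))"
proof -
  obtain pg qg where g: "\<And>x. \<exists>t. exec pg (encode x) t (encode (g x)) \<and> t \<le> poly qg (tsize x)"
    "\<And>x. tsize (g x) \<le> poly qg (tsize x)"
    using assms(1) by (rule ptimeE) blast
  obtain pf qf where f: "\<And>x. \<exists>t. exec pf (encode x) t (encode (f x)) \<and> t \<le> poly qf (tsize x)"
    "\<And>x. tsize (f x) \<le> poly qf (tsize x)"
    using assms(2) by (rule ptimeE) blast
  have g_le: "poly qg (tsize (f x)) \<le> poly (qg \<circ>\<^sub>p qf) (tsize x)" for x
    using f(2)[of x] by (simp add: poly_pcompose poly_mono_nat)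
  show ?thesis
  proof (rule ptimeI[where p = "PSeq pf pg" and q = "qf + (qg \<circ>\<^sub>p qf) + 1" and r = "qg \<circ>\<^sub>p qf"])
    fix x
    obtain s t where "exec pf (encode x) s (encode (f x))" "s \<le> poly qf (tsize x)"
      "exec pg (encode (f x)) t (encode (g (f x)))" "t \<le> poly qg (tsize (f x))"
      using f(1) g(1) by meson
    then show "\<exists>t. exec (PSeq pf pg) (encode x) t (encode (g (f x))) \<and>
        t \<le> poly (qf + (qg \<circ>\<^sub>p qf) + 1) (tsize x)"
      using g_le[of x] by (intro exI[of _ "s + t + 1"] conjI exec.Seq) auto
    show "tsize (g (f x)) \<le> poly (qg \<circ>\<^sub>p qf) (tsize x)"
      using g(2)[of "f x"] g_le[of x] by linarith
  qed
qed

text \<open>Pairs, nonempty lists and \<open>Some\<close> all have a single cons cell at the root,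
  so one program scheme serves these constructors.\<close>

lemma ptime_cons_tree:
  assumes "ptime f" "ptime g" and h: "\<And>x. encode (h x) = Cons (encode (f x)) (encode (g x))"
  shows "ptime h"
proof -
  obtain pg qg where g: "\<And>x. \<exists>t. exec pg (encode x) t (encode (g x)) \<and> t \<le> poly qg (tsize x)"
    "\<And>x. tsize (g x) \<le> poly qg (tsize x)"
    using assms(2) by (rule ptimeE) blast
  obtain pf qf where f: "\<And>x. \<exists>t. exec pf (encode x) t (encode (f x)) \<and> t \<le> poly qf (tsize x)"
    "\<And>x. tsize (f x) \<le> poly qf (tsize x)"
    using assms(1) by (rule ptimeE) blast
  show ?thesis
  proof (rule ptimeI[where p = "PCons pf pg" and q = "qf + qg + 1" and r = "qf + qg + 1"])
    fix x
    obtain s t where "exec pf (encode x) s (encode (f x))" "s \<le> poly qf (tsize x)"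
      "exec pg (encode x) t (encode (g x))" "t \<le> poly qg (tsize x)"
      using f(1) g(1) by meson
    then show "\<exists>t. exec (PCons pf pg) (encode x) t (encode (h x)) \<and>
        t \<le> poly (qf + qg + 1) (tsize x)"
      unfolding h by (intro exI[of _ "s + t + 1"] conjI exec.Cons) auto
    show "tsize (h x) \<le> poly (qf + qg + 1) (tsize x)"
      using f(2)[of x] g(2)[of x] by (simp add: h)
  qed
qed

lemma ptime_Pair [ptime_intros]:
  "ptime f \<Longrightarrow> ptime g \<Longrightarrow> ptime (\<lambda>x. (f x, g x))"
  by (erule ptime_cons_tree) auto

lemma ptime_Cons [ptime_intros]:
  "ptime f \<Longrightarrow> ptime g \<Longrightarrow> ptime (\<lambda>x. f x # g x)"
  by (erule ptime_cons_tree) auto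

lemma exec_const: "\<exists>p s. \<forall>x. exec p x s t"
proof (induction t)
  case Atom
  then show ?case using exec.Atom by blast
next
  case (Cons t u)
  then show ?case using exec.Cons by meson
qed

lemma ptime_const [ptime_intros]: "ptime (\<lambda>_. k)"
proof -
  obtain p s where "\<And>x. exec p x s (encode k)" using exec_const by metis
  then show ?thesis
    by (intro ptimeI[where p = p and q = "[:s:]" and r = "[:tsize k:]"]) auto
qed

lemma ptime_Some [ptime_intros]: "ptime f \<Longrightarrow> ptime (\<lambda>x. Some (f x))"
  by (erule ptime_cons_tree[OF _ ptime_const[of Atom]]) auto

lemma size_left_le: "size (left t) \<le> size t" and size_right_le: "size (right t) \<le> size t"
  by (cases t; simp)+

lemma ptime_left: assumes "\<And>x. encode (f x) = left (encode x)" shows "ptime f"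
proof (rule ptimeI[where p = PLeft and q = 1 and r = "[:0, 1:]"])
  show "\<exists>t. exec PLeft (encode x) t (encode (f x)) \<and> t \<le> poly 1 (tsize x)" for x
    using assms exec.Left by auto
qed (simp add: assms size_left_le)

lemma ptime_right: assumes "\<And>x. encode (f x) = right (encode x)" shows "ptime f"
proof (rule ptimeI[where p = PRight and q = 1 and r = "[:0, 1:]"])
  show "\<exists>t. exec PRight (encode x) t (encode (f x)) \<and> t \<le> poly 1 (tsize x)" for x
    using assms exec.Right by auto
qed (simp add: assms size_right_le)

lemma ptime_fst [ptime_intros]: "ptime f \<Longrightarrow> ptime (\<lambda>x. fst (f x))"
  by (rule ptime_comp[of fst]) (auto intro: ptime_left simp: encode_prod_def)

lemma ptime_snd [ptime_intros]: "ptime f \<Longrightarrow> ptime (\<lambda>x. snd (f x))"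
  by (rule ptime_comp[of snd]) (auto intro: ptime_right simp: encode_prod_def)

lemma ptime_tl [ptime_intros]: "ptime f \<Longrightarrow> ptime (\<lambda>x. tl (f x))"
proof (rule ptime_comp[of tl], rule ptime_right)
  show "encode (tl x) = right (encode x)" for x :: "'b list" by (cases x) auto
qed

lemma ptime_if_tree:
  assumes "ptime b" "ptime f" "ptime g"
  shows "ptime (\<lambda>x. if encode (b x) \<noteq> Atom then f x else g x)"
proof -
  obtain pb qb where b: "\<And>x. \<exists>t. exec pb (encode x) t (encode (b x)) \<and> t \<le> poly qb (tsize x)"
    using assms(1) by (rule ptimeE) blast
  obtain pg qg where g: "\<And>x. \<exists>t. exec pg (encode x) t (encode (g x)) \<and> t \<le> poly qg (tsize x)"
    "\<And>x. tsize (g x) \<le> poly qg (tsize x)"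
    using assms(3) by (rule ptimeE) blast
  obtain pf qf where f: "\<And>x. \<exists>t. exec pf (encode x) t (encode (f x)) \<and> t \<le> poly qf (tsize x)"
    "\<And>x. tsize (f x) \<le> poly qf (tsize x)"
    using assms(2) by (rule ptimeE) blast
  show ?thesis
  proof (rule ptimeI[where p = "PIf pb pf pg" and q = "qb + qf + qg + 1" and r = "qf + qg"])
    fix x
    obtain s where s: "exec pb (encode x) s (encode (b x))" "s \<le> poly qb (tsize x)"
      using b by blast
    obtain t u where t: "exec pf (encode x) t (encode (f x))" "t \<le> poly qf (tsize x)"
      "exec pg (encode x) u (encode (g x))" "u \<le> poly qg (tsize x)"
      using f(1) g(1) by meson
    show "\<exists>t. exec (PIf pb pf pg) (encode x) t (encode (if encode (b x) \<noteq> Atom then f x else g x)) \<and>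
        t \<le> poly (qb + qf + qg + 1) (tsize x)"
    proof (cases "encode (b x) = Atom")
      case True
      then show ?thesis
        using s t by (intro exI[of _ "s + u + 1"]) (auto intro: exec.If_False[simplified])
    next
      case False
      then show ?thesis
        using s t by (intro exI[of _ "s + t + 1"]) (auto intro: exec.If_True[simplified])
    qed
    show "tsize (if encode (b x) \<noteq> Atom then f x else g x) \<le> poly (qf + qg) (tsize x)"
      using f(2)[of x] g(2)[of x] by auto
  qed
qed

lemma encode_eq_Atom_iff [simp]:
  "encode (b :: bool) = Atom \<longleftrightarrow> \<not> b"
  "encode (xs :: 'a::enc list) = Atom \<longleftrightarrow> xs = []"
  "encode (y :: 'a::enc option) = Atom \<longleftrightarrow> y = None"
  "encode (n :: nat) = Atom \<longleftrightarrow> n = 0"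
  "encode (d :: orientation) = Atom \<longleftrightarrow> d = Horizontal"
proof -
  show "encode b = Atom \<longleftrightarrow> \<not> b" by (cases b) simp_all
  show "encode xs = Atom \<longleftrightarrow> xs = []" by (cases xs) simp_all
  show "encode y = Atom \<longleftrightarrow> y = None" by (cases y) simp_all
  show "encode n = Atom \<longleftrightarrow> n = 0" by (simp add: encode_nat_def enc_nat.simps[of n])
  show "encode d = Atom \<longleftrightarrow> d = Horizontal" by (cases d) simp_all
qed

lemma ptime_if [ptime_intros]:
  "ptime b \<Longrightarrow> ptime f \<Longrightarrow> ptime g \<Longrightarrow> ptime (\<lambda>x. if b x then f x else g x)"
  using ptime_if_tree[of b f g] by simp

lemma ptime_not_Nil:
  assumes "ptime xs" shows "ptime (\<lambda>x. xs x \<noteq> [])"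
proof -
  have "(\<lambda>x. xs x \<noteq> []) = (\<lambda>x. if encode (xs x) \<noteq> Atom then True else False)" by auto
  with ptime_if_tree[OF assms ptime_const[of True] ptime_const[of False]] show ?thesis by simp
qed

lemma ptime_case_list [ptime_intros]:
  fixes xs :: "'a::enc \<Rightarrow> 'b::enc list"
  assumes "ptime xs" "ptime f" "ptime (\<lambda>z. g (fst z) (fst (snd z)) (snd (snd z)))"
  shows "ptime (\<lambda>x. case xs x of [] \<Rightarrow> f x | y # ys \<Rightarrow> g x y ys)"
proof -
  obtain p q where p: "\<And>x. \<exists>t. exec p (encode x) t (encode (g (fst x) (fst (snd x)) (snd (snd x)))) \<and>
      t \<le> poly q (tsize x)" "\<And>x. tsize (g (fst x) (fst (snd x)) (snd (snd x))) \<le> poly q (tsize x)"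
    using assms(3) by (rule ptimeE) blast
  obtain px qx where xs: "\<And>x. \<exists>t. exec px (encode x) t (encode (xs x)) \<and> t \<le> poly qx (tsize x)"
    "\<And>x. tsize (xs x) \<le> poly qx (tsize x)"
    using assms(1) by (rule ptimeE) blast
  obtain pf qf where f: "\<And>x. \<exists>t. exec pf (encode x) t (encode (f x)) \<and> t \<le> poly qf (tsize x)"
    "\<And>x. tsize (f x) \<le> poly qf (tsize x)"
    using assms(2) by (rule ptimeE) blast
  let ?r = "[:2, 1:] + qx"
  \<comment> \<open>\<open>(x, y, ys)\<close> and \<open>(x, y # ys)\<close> have the same tree, so
    pairing the input with the list already yields the argument of \<open>p\<close>.\<close>
  let ?P = "PIf px (PSeq (PCons PId px) p) pf"
  show ?thesis
  proof (rule ptimeI[where p = ?P and q = "qx + qx + [:5:] + (q \<circ>\<^sub>p ?r) + qf" and r = "(q \<circ>\<^sub>p ?r) + qf"])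
    fix x
    obtain s where s: "exec px (encode x) s (encode (xs x))" "s \<le> poly qx (tsize x)"
      using xs(1) by blast
    obtain t where t: "exec pf (encode x) t (encode (f x))" "t \<le> poly qf (tsize x)"
      using f(1) by blast
    have le: "poly q (tsize (x, y, ys)) \<le> poly (q \<circ>\<^sub>p ?r) (tsize x)" if "xs x = y # ys" for y ys
      using xs(2)[of x] that by (simp add: poly_pcompose poly_mono_nat)
    show "\<exists>t. exec ?P (encode x) t (encode (case xs x of [] \<Rightarrow> f x | y # ys \<Rightarrow> g x y ys)) \<and>
       t \<le> poly (qx + qx + [:5:] + (q \<circ>\<^sub>p ?r) + qf) (tsize x)"
    proof (cases "xs x")
      case Nil
      with s t show ?thesis by (intro exI[of _ "s + t + 1"]) (auto intro: exec.If_False[simplified])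
    next
      case (Cons y ys)
      obtain u where u: "exec p (encode (x, y, ys)) u (encode (g x y ys))" "u \<le> poly q (tsize (x, y, ys))"
        using p(1)[of "(x, y, ys)"] by auto
      have "exec (PSeq (PCons PId px) p) (encode x) ((1 + s + 1) + u + 1) (encode (g x y ys))"
        using s u(1) Cons by (intro exec.Seq[OF exec.Cons[OF exec.Id]]) auto
      from exec.If_True[OF s(1) _ this] Cons have
        "exec ?P (encode x) (s + ((1 + s + 1) + u + 1) + 1) (encode (g x y ys))" by simp
      then show ?thesis
        using s u le[OF Cons] Cons by (intro exI conjI) auto
    qed
    show "tsize (case xs x of [] \<Rightarrow> f x | y # ys \<Rightarrow> g x y ys) \<le> poly (q \<circ>\<^sub>p ?r + qf) (tsize x)"
    proof (cases "xs x")
      case Nil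
      with f(2)[of x] show ?thesis by simp
    next
      case (Cons y ys)
      with p(2)[of "(x, y, ys)"] le[OF Cons] show ?thesis by simp
    qed
  qed
qed

lemma ptime_comp2:
  assumes "ptime (\<lambda>z. h (fst z) (snd z))" "ptime f" "ptime g"
  shows "ptime (\<lambda>x. h (f x) (g x))"
  using ptime_comp[OF assms(1) ptime_Pair[OF assms(2,3)]] by simp

lemma ptime_comp3:
  assumes "ptime (\<lambda>z. h (fst z) (fst (snd z)) (snd (snd z)))" "ptime f" "ptime g" "ptime k"
  shows "ptime (\<lambda>x. h (f x) (g x) (k x))"
  using ptime_comp[OF assms(1) ptime_Pair[OF assms(2) ptime_Pair[OF assms(3,4)]]] by simp

subsection \<open>Loops\<close>

text \<open>\<open>\<mu>\<close> bounds the number of rounds. The potential \<open>\<beta>\<close>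
  never grows and dominates the size, so every state reached has size at most \<open>B\<close>, and
  one bound \<open>T\<close> serves each test and each body.\<close>

lemma exec_while:
  fixes b :: "'s::enc \<Rightarrow> bool"
  assumes b: "\<And>s. tsize s \<le> B \<Longrightarrow> \<exists>t. exec pb (encode s) t (encode (b s)) \<and> t \<le> T"
    and f: "\<And>s. tsize s \<le> B \<Longrightarrow> \<exists>t. exec pf (encode s) t (encode (f s)) \<and> t \<le> T"
    and g: "\<And>s. g s = (if b s then g (f s) else s)"
    and \<mu>: "\<And>s. b s \<Longrightarrow> \<mu> (f s) < (\<mu> s :: nat)"
    and \<beta>: "\<And>s. b s \<Longrightarrow> \<beta> (f s) \<le> (\<beta> s :: nat)" "\<And>s. tsize s \<le> \<beta> s"
    and "\<beta> s \<le> B"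
  shows "\<exists>t. exec (PWhile pb pf) (encode s) t (encode (g s)) \<and> t \<le> (\<mu> s + 1) * (2 * T + 1)"
  using \<open>\<beta> s \<le> B\<close>
proof (induction "\<mu> s" arbitrary: s rule: less_induct)
  case less
  have sB: "tsize s \<le> B" using less.prems \<beta>(2)[of s] by linarith
  obtain t1 where t1: "exec pb (encode s) t1 (encode (b s))" "t1 \<le> T" using b[OF sB] by blast
  show ?case
  proof (cases "b s")
    case False
    then have "exec (PWhile pb pf) (encode s) (t1 + 1) (encode (g s))"
      using t1(1) g[of s] by (auto intro: exec.While_False[simplified])
    moreover have "t1 + 1 \<le> (\<mu> s + 1) * (2 * T + 1)" using t1(2) by simp
    ultimately show ?thesis by blast
  next
    case True
    obtain t2 where t2: "exec pf (encode s) t2 (encode (f s))" "t2 \<le> T" using f[OF sB] by blast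
    have "\<beta> (f s) \<le> B" using \<beta>(1)[OF True] less.prems by linarith
    from less.hyps[OF \<mu>[OF True] this] obtain t3 where
      t3: "exec (PWhile pb pf) (encode (f s)) t3 (encode (g (f s)))"
        "t3 \<le> (\<mu> (f s) + 1) * (2 * T + 1)" by blast
    have "exec (PWhile pb pf) (encode s) (t1 + t2 + t3 + 1) (encode (g s))"
      using exec.While_True[OF t1(1) _ t2(1) t3(1)] True g[of s] by simp
    moreover have "(\<mu> (f s) + 1) * (2 * T + 1) \<le> \<mu> s * (2 * T + 1)"
      using \<mu>[OF True] by (intro mult_right_mono) auto
    then have "t1 + t2 + t3 + 1 \<le> (\<mu> s + 1) * (2 * T + 1)"
      using t1(2) t2(2) t3(2) by simp
    ultimately show ?thesis by blast
  qed
qed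

text \<open>Polynomial growth in each round could iterate to exponential size; the nonincreasing
  potential \<open>\<beta>\<close>, polynomial in the initial size, excludes this.\<close>

lemma ptime_while:
  fixes b :: "'s::enc \<Rightarrow> bool"
  assumes "ptime b" "ptime f"
    and g: "\<And>s. g s = (if b s then g (f s) else s)"
    and \<mu>: "\<And>s. b s \<Longrightarrow> \<mu> (f s) < (\<mu> s :: nat)" "\<And>s. \<mu> s \<le> poly q\<mu> (tsize s)"
    and \<beta>: "\<And>s. b s \<Longrightarrow> \<beta> (f s) \<le> (\<beta> s :: nat)" "\<And>s. tsize s \<le> \<beta> s"
      "\<And>s. \<beta> s \<le> poly q\<beta> (tsize s)"
  shows "ptime g"
proof -
  obtain pb qb where b: "\<And>x. \<exists>t. exec pb (encode x) t (encode (b x)) \<and> t \<le> poly qb (tsize x)"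
    using assms(1) by (rule ptimeE) blast
  obtain pf qf where f: "\<And>x. \<exists>t. exec pf (encode x) t (encode (f x)) \<and> t \<le> poly qf (tsize x)"
    using assms(2) by (rule ptimeE) blast
  have "\<beta> (g s) \<le> \<beta> s" for s :: 's
  proof (induction "\<mu> s" arbitrary: s rule: less_induct)
    case less
    show ?case
      using g[of s] less.hyps[of "f s"] \<mu>(1)[of s] \<beta>(1)[of s] by (cases "b s") auto
  qed
  then have size: "tsize (g s) \<le> poly q\<beta> (tsize s)" for s :: 's
    using \<beta>(2)[of "g s"] \<beta>(3)[of s] by (meson le_trans)
  let ?T = "(qb + qf) \<circ>\<^sub>p q\<beta>"
  show ?thesis
  proof (rule ptimeI[where p = "PWhile pb pf" and q = "(q\<mu> + 1) * (smult 2 ?T + 1)" and r = q\<beta>, OF _ size])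
    fix s :: 's
    let ?B = "poly q\<beta> (tsize s)" and ?t = "poly ?T (tsize s)"
    have T: "poly qb n \<le> ?t" "poly qf n \<le> ?t" if "n \<le> ?B" for n
      using poly_mono_nat[OF that, of qb] poly_mono_nat[OF that, of qf] by (simp_all add: poly_pcompose)
    have "\<exists>t. exec (PWhile pb pf) (encode s) t (encode (g s)) \<and> t \<le> (\<mu> s + 1) * (2 * ?t + 1)"
      using exec_while[where b = b and f = f and g = g and \<mu> = \<mu> and \<beta> = \<beta> and B = ?B and T = ?t, OF _ _ g \<mu>(1) \<beta>(1,2,3)]
        b f T by (meson le_trans)
    moreover have "(\<mu> s + 1) * (2 * ?t + 1) \<le> (poly q\<mu> (tsize s) + 1) * (2 * ?t + 1)"
      using \<mu>(2)[of s] by (intro mult_right_mono) auto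
    ultimately show "\<exists>t. exec (PWhile pb pf) (encode s) t (encode (g s)) \<and>
        t \<le> poly ((q\<mu> + 1) * (smult 2 ?T + 1)) (tsize s)"
      by (auto intro: le_trans)
  qed
qed

text \<open>\<open>\<phi> c l s\<close> accounts for the present size of the state and for all
  growth that the remaining items \<open>l\<close> may still cause.\<close>

lemma ptime_fold_potential:
  fixes step :: "'c::enc \<Rightarrow> 'a::enc \<Rightarrow> 's::enc \<Rightarrow> 's"
  assumes xs: "ptime xs" and s0: "ptime s0"
    and step: "ptime (\<lambda>z. step (fst z) (fst (snd z)) (snd (snd z)))"
    and \<phi>: "\<And>c x l s. \<phi> c l (step c x s) \<le> (\<phi> c (x # l) s :: nat)" "\<And>c l s. tsize s \<le> \<phi> c l s"
      "\<And>c l s. \<phi> c l s \<le> poly r (tsize c + tsize l + tsize s)"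
  shows "ptime (\<lambda>c. fold (step c) (xs c) (s0 c))"
proof -
  let ?b = "\<lambda>z :: 'c \<times> 'a list \<times> 's. fst (snd z) \<noteq> []"
  let ?f = "\<lambda>z :: 'c \<times> 'a list \<times> 's. case fst (snd z) of [] \<Rightarrow> z |
    x # l \<Rightarrow> (fst z, l, step (fst z) x (snd (snd z)))"
  let ?g = "\<lambda>z :: 'c \<times> 'a list \<times> 's. (fst z, [] :: 'a list, fold (step (fst z)) (fst (snd z)) (snd (snd z)))"
  let ?\<beta> = "\<lambda>z :: 'c \<times> 'a list \<times> 's. tsize (fst z) + tsize (fst (snd z)) + 2 + \<phi> (fst z) (fst (snd z)) (snd (snd z))"
  have "ptime ?g"
  proof (rule ptime_while[where b = ?b and f = ?f and \<mu> = "\<lambda>z. length (fst (snd z))" and \<beta> = ?\<beta>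
        and q\<mu> = "[:0, 1:]" and q\<beta> = "[:2, 1:] + r"])
    show "ptime ?b" by (intro ptime_not_Nil ptime_intros)
    show "ptime ?f" by (intro ptime_comp3[OF step] ptime_case_list ptime_intros)
    fix z :: "'c \<times> 'a list \<times> 's"
    show "?g z = (if ?b z then ?g (?f z) else z)"
      by (cases "fst (snd z)") (auto simp: prod_eq_iff)
    show "length (fst (snd z)) \<le> poly [:0, 1:] (tsize z)"
      using length_le_tsize[of "fst (snd z)"] by simp
    show "?b z \<Longrightarrow> length (fst (snd (?f z))) < length (fst (snd z))"
      by (cases "fst (snd z)") auto
    show "?b z \<Longrightarrow> ?\<beta> (?f z) \<le> ?\<beta> z"
      using \<phi>(1) by (cases "fst (snd z)") (auto intro!: le_SucI trans_le_add2)
    show "tsize z \<le> ?\<beta> z"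
      using \<phi>(2) by (auto intro: add_mono)
    have "poly r (tsize (fst z) + tsize (fst (snd z)) + tsize (snd (snd z))) \<le> poly r (tsize z)"
      by (intro poly_mono_nat) simp
    with \<phi>(3)[of "fst z" "fst (snd z)" "snd (snd z)"] show "?\<beta> z \<le> poly ([:2, 1:] + r) (tsize z)"
      by simp
  qed
  moreover have "ptime (\<lambda>c. (c, xs c, s0 c))" by (intro ptime_intros xs s0)
  ultimately have "ptime (\<lambda>c. ?g (c, xs c, s0 c))" by (rule ptime_comp)
  from ptime_snd[OF ptime_snd[OF this]] show ?thesis by simp
qed

text \<open>Growth that does not depend on the state adds up over the list: the potential is the
  present size plus the allowances of the remaining items.\<close>

lemma ptime_fold:
  fixes step :: "'c::enc \<Rightarrow> 'a::enc \<Rightarrow> 's::enc \<Rightarrow> 's"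
  assumes xs: "ptime xs" and s0: "ptime s0"
    and step: "ptime (\<lambda>z. step (fst z) (fst (snd z)) (snd (snd z)))"
    and growth: "\<And>c x s. tsize (step c x s) \<le> tsize s + poly r (tsize c + tsize x)"
  shows "ptime (\<lambda>c. fold (step c) (xs c) (s0 c))"
proof (rule ptime_fold_potential[OF xs s0 step, where r = "[:0, 1:] + [:0, 1:] * r"
    and \<phi> = "\<lambda>c l s. tsize s + (\<Sum>x\<leftarrow>l. poly r (tsize c + tsize x))"])
  fix c :: 'c and l :: "'a list" and s :: 's and x
  show "tsize (step c x s) + (\<Sum>x\<leftarrow>l. poly r (tsize c + tsize x)) \<le>
      tsize s + (\<Sum>x\<leftarrow>x # l. poly r (tsize c + tsize x))"
    using growth[where c = c and x = x and s = s] by simp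
  have "(\<Sum>x\<leftarrow>l. poly r (tsize c + tsize x)) \<le> (\<Sum>x\<leftarrow>l. poly r (tsize c + tsize l + tsize s))"
    by (intro sum_list_mono poly_mono_nat) (auto dest: tsize_member)
  also have "\<dots> = length l * poly r (tsize c + tsize l + tsize s)" by (simp add: sum_list_triv)
  also have "\<dots> \<le> (tsize c + tsize l + tsize s) * poly r (tsize c + tsize l + tsize s)"
    using length_le_tsize[of l] by (intro mult_right_mono) auto
  finally show "tsize s + (\<Sum>x\<leftarrow>l. poly r (tsize c + tsize x)) \<le>
      poly ([:0, 1:] + [:0, 1:] * r) (tsize c + tsize l + tsize s)" by simp
qed simp

subsection \<open>Booleans and equality\<close>

lemma ptime_conj [ptime_intros]: "ptime f \<Longrightarrow> ptime g \<Longrightarrow> ptime (\<lambda>x. f x \<and> g x)"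
proof -
  assume "ptime f" "ptime g"
  then have "ptime (\<lambda>x. if f x then g x else False)" by (intro ptime_if ptime_const)
  moreover have "(\<lambda>x. f x \<and> g x) = (\<lambda>x. if f x then g x else False)" by auto
  ultimately show ?thesis by simp
qed

lemma ptime_not [ptime_intros]: "ptime f \<Longrightarrow> ptime (\<lambda>x. \<not> f x)"
  by (rule arg_cong[where f = ptime, THEN iffD1, rotated,
        OF ptime_if[OF _ ptime_const[of False] ptime_const[of True]]]) auto

lemma ptime_disj [ptime_intros]: "ptime f \<Longrightarrow> ptime g \<Longrightarrow> ptime (\<lambda>x. f x \<or> g x)"
  using ptime_not[OF ptime_conj[OF ptime_not ptime_not], of f g] by simp

lemma ptime_imp [ptime_intros]: "ptime f \<Longrightarrow> ptime g \<Longrightarrow> ptime (\<lambda>x. f x \<longrightarrow> g x)"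
  using ptime_disj[OF ptime_not, of f g] by simp

lemma ptime_eq_Atom:
  assumes "ptime f" shows "ptime (\<lambda>x. encode (f x) = Atom)"
  by (rule arg_cong[where f = ptime, THEN iffD1, rotated,
        OF ptime_if_tree[OF assms ptime_const[of False] ptime_const[of True]]]) auto

lemma ptime_encode: "ptime f \<Longrightarrow> ptime (\<lambda>x. encode (f x))"
  by (rule ptime_comp[of encode]) (auto intro: ptime_recode)

text \<open>Two trees are compared by means of a stack of pairs of subtrees still to be compared.\<close>

lemma ptime_tree_eq: "ptime (\<lambda>p :: tree \<times> tree. fst p = snd p)"
proof -
  let ?b = "\<lambda>z :: bool \<times> (tree \<times> tree) list. snd z \<noteq> []"
  let ?f = "\<lambda>z :: bool \<times> (tree \<times> tree) list. case snd z of [] \<Rightarrow> z | p # st \<Rightarrow>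
     if encode (fst p) = Atom then if encode (snd p) = Atom then (fst z, st) else (False, [])
     else if encode (snd p) = Atom then (False, [])
     else (fst z, (left (fst p), left (snd p)) # (right (fst p), right (snd p)) # st)"
  let ?g = "\<lambda>z :: bool \<times> (tree \<times> tree) list.
    (fst z \<and> (\<forall>p \<in> set (snd z). fst p = snd p), [] :: (tree \<times> tree) list)"
  \<comment> \<open>Splitting a pair replaces its term by two terms whose sum is smaller by one. A
    mismatch empties the stack.\<close>
  let ?\<mu> = "\<lambda>z :: bool \<times> (tree \<times> tree) list. \<Sum>p\<leftarrow>snd z. 2 * size (fst p) + 1"
  have left: "ptime (\<lambda>x. left (h x))" if "ptime h" for h :: "'c::enc \<Rightarrow> tree"
    by (rule ptime_comp[OF ptime_left that]) simp
  have right: "ptime (\<lambda>x. right (h x))" if "ptime h" for h :: "'c::enc \<Rightarrow> tree"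
    by (rule ptime_comp[OF ptime_right that]) simp
  have "ptime ?g"
  proof (rule ptime_while[where b = ?b and f = ?f and \<mu> = ?\<mu> and \<beta> = tsize
        and q\<mu> = "[:0, 2:]" and q\<beta> = "[:0, 1:]"])
    show "ptime ?b" by (intro ptime_not_Nil ptime_intros)
    show "ptime ?f" by (intro ptime_eq_Atom left right ptime_intros)
    fix z :: "bool \<times> (tree \<times> tree) list"
    obtain ok st where z: "z = (ok, st)" by (cases z)
    show "?g z = (if ?b z then ?g (?f z) else z)"
    proof (cases st)
      case (Cons p st')
      then show ?thesis by (cases "fst p"; cases "snd p") (auto simp: z)
    qed (simp add: z)
    show "?\<mu> (?f z) < ?\<mu> z" if "?b z"
    proof (cases st)
      case (Cons p st')
      then show ?thesis by (cases "fst p"; cases "snd p") (auto simp: z)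
    qed (use that z in auto)
    \<comment> \<open>Splitting a pair frees as many cells as it uses, so the size itself can be the
      potential.\<close>
    show "tsize (?f z) \<le> tsize z" if "?b z"
    proof (cases st)
      case (Cons p st')
      then show ?thesis by (cases "fst p"; cases "snd p") (auto simp: z)
    qed (use that z in auto)
    have "(\<Sum>p\<leftarrow>st. 2 * size (fst p) + 1) \<le> 2 * tsize st"
      by (induction st) auto
    then show "?\<mu> z \<le> poly [:0, 2:] (tsize z)" by (simp add: z)
  qed auto
  from ptime_fst[OF ptime_comp[OF this, of "\<lambda>p. (True, [p])"]] show ?thesis
    by (simp add: ptime_intros)
qed

lemma ptime_eq [ptime_intros]:
  assumes "ptime f" "ptime g" shows "ptime (\<lambda>x. f x = g x)"
  using ptime_comp[OF ptime_tree_eq ptime_Pair[OF ptime_encode[OF assms(1)] ptime_encode[OF assms(2)]]]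
  by (simp add: encode_inject)

subsection \<open>Lists\<close>

lemma ptime_rev [ptime_intros]: "ptime xs \<Longrightarrow> ptime (\<lambda>c. rev (xs c))"
  unfolding rev_conv_fold by (intro ptime_fold[where r = "[:1, 1:]"] ptime_intros) auto

lemma ptime_append [ptime_intros]:
  assumes "ptime xs" "ptime ys" shows "ptime (\<lambda>c. xs c @ ys c)"
proof -
  have "ptime (\<lambda>c. fold (\<lambda>x s. x # s) (rev (xs c)) (ys c))"
    by (intro ptime_fold[where r = "[:1, 1:]"] ptime_intros assms) auto
  then show ?thesis by (simp add: fold_Cons_rev)
qed

lemma ptime_concat [ptime_intros]: "ptime xss \<Longrightarrow> ptime (\<lambda>c. concat (xss c))"
proof -
  assume "ptime xss"
  then have "ptime (\<lambda>c. fold (\<lambda>xs s. xs @ s) (rev (xss c)) [])"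
    by (intro ptime_fold[where r = "[:0, 1:]"] ptime_intros) (simp_all add: tsize_append)
  then show ?thesis by (simp add: foldr_conv_fold[symmetric] concat_conv_foldr)
qed

lemma ptime_map [ptime_intros]:
  assumes "ptime xs" "ptime (\<lambda>z. f (fst z) (snd z))"
  shows "ptime (\<lambda>c. map (f c) (xs c))"
proof -
  obtain q where q: "\<And>z. tsize (f (fst z) (snd z)) \<le> poly q (tsize z)"
    using assms(2) by (rule ptime_tsize) (rule that)
  have "ptime (\<lambda>c. fold (\<lambda>x s. f c x # s) (rev (xs c)) [])"
  proof (intro ptime_fold[where r = "(q \<circ>\<^sub>p [:1, 1:]) + 1"] ptime_intros assms(1) ptime_comp2[OF assms(2)])
    show "tsize (f c x # s) \<le> tsize s + poly ((q \<circ>\<^sub>p [:1, 1:]) + 1) (tsize c + tsize x)" for c x s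
      using q[of "(c, x)"] by (simp add: poly_pcompose)
  qed
  moreover have "fold (\<lambda>x s. f c x # s) (rev l) [] = map (f c) l" for c l
    by (induction l) auto
  ultimately show ?thesis by simp
qed

lemma ptime_filter [ptime_intros]:
  assumes "ptime xs" "ptime (\<lambda>z. P (fst z) (snd z))"
  shows "ptime (\<lambda>c. filter (P c) (xs c))"
proof -
  have "ptime (\<lambda>c. fold (\<lambda>x s. if P c x then x # s else s) (rev (xs c)) [])"
    by (intro ptime_fold[where r = "[:1, 1:]"] ptime_intros assms(1) ptime_comp2[OF assms(2)]) auto
  moreover have "fold (\<lambda>x s. if P x then x # s else s) (rev l) [] = filter P l" for P and l :: "'b list"
    by (induction l) auto
  ultimately show ?thesis by simp
qed

lemma ptime_Ball [ptime_intros]: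
  assumes "ptime xs" "ptime (\<lambda>z. P (fst z) (snd z))"
  shows "ptime (\<lambda>c. \<forall>x \<in> set (xs c). P c x)"
proof -
  have "ptime (\<lambda>c. filter (\<lambda>x. \<not> P c x) (xs c) = [])"
    by (intro ptime_intros assms(1) ptime_comp2[OF assms(2)])
  then show ?thesis by (simp add: filter_empty_conv)
qed

lemma ptime_member [ptime_intros]:
  assumes "ptime f" "ptime xs" shows "ptime (\<lambda>c. f c \<in> set (xs c))"
proof -
  have "ptime (\<lambda>c. \<not> (\<forall>x \<in> set (xs c). f c \<noteq> x))"
    by (intro ptime_intros ptime_comp[OF assms(1)] assms(2))
  then show ?thesis by (rule arg_cong[where f = ptime, THEN iffD1, rotated]) auto
qed

text \<open>This removes duplicates; in \<open>letters\<close>, a cell on whose letter two words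
  agree then occurs once.\<close>

lemma ptime_fold_insert [ptime_intros]:
  assumes "ptime xs" shows "ptime (\<lambda>c. fold List.insert (xs c) [])"
proof (rule ptime_fold[OF assms ptime_const])
  show "ptime (\<lambda>z :: 'a \<times> 'b \<times> 'b list. List.insert (fst (snd z)) (snd (snd z)))"
    unfolding List.insert_def by (intro ptime_intros)
  show "tsize (List.insert x s) \<le> tsize s + poly [:1, 1:] (tsize c + tsize x)" for x :: 'b and s and c :: 'a
    by (simp add: List.insert_def)
qed

subsection \<open>Binary arithmetic\<close>

text \<open>Zero is \<open>Atom\<close>, so attaching a low bit 0 to the number 0 must not create a
  cell; hence the case distinction.\<close>

lemma encode_nat_bit:
  "encode (of_bool b + 2 * n :: nat) = (if b \<or> n \<noteq> 0 then Cons (encode b) (encode n) else Atom)"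
  by (cases b) (auto simp: encode_nat_def enc_nat.simps[of "Suc _"] enc_nat.simps[of "2 * n"])

lemma ptime_tree_Cons: "ptime f \<Longrightarrow> ptime g \<Longrightarrow> ptime (\<lambda>x. tree.Cons (f x) (g x))"
  by (erule ptime_cons_tree) auto

lemma ptime_nat_bit:
  assumes "ptime b" "ptime n" shows "ptime (\<lambda>x. of_bool (b x) + 2 * n x :: nat)"
proof -
  have "ptime (\<lambda>x. if b x \<or> \<not> encode (n x) = Atom then Cons (encode (b x)) (encode (n x)) else Atom)"
    by (intro ptime_if ptime_disj ptime_not ptime_eq_Atom ptime_const assms ptime_tree_Cons ptime_encode)
  moreover have "(\<lambda>x. encode (of_bool (b x) + 2 * n x :: nat)) =
      (\<lambda>x. if b x \<or> \<not> encode (n x) = Atom then Cons (encode (b x)) (encode (n x)) else Atom)"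
    by (simp add: encode_nat_bit fun_eq_iff)
  ultimately have "ptime (\<lambda>x. encode (of_bool (b x) + 2 * n x :: nat))" by simp
  then show ?thesis by (simp add: ptime_def)
qed

fun bits :: "nat \<Rightarrow> bool list" where
  "bits n = (if n = 0 then [] else odd n # bits (n div 2))"

declare bits.simps [simp del]

lemma encode_bits: "encode (bits n) = encode n"
proof (induction n rule: bits.induct)
  case (1 n)
  then show ?case
    by (simp add: bits.simps[of n] encode_nat_def enc_nat.simps[of n])
qed

lemma ptime_bits: "ptime n \<Longrightarrow> ptime (\<lambda>x. bits (n x))"
  by (rule ptime_comp[of bits, OF ptime_recode]) (simp_all add: encode_bits)

definition unbits :: "bool list \<Rightarrow> nat" where
  "unbits bs = foldr (\<lambda>b n. of_bool b + 2 * n) bs 0"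

text \<open>The default \<open>False\<close>, together with \<open>tl [] = []\<close>, pads an
  exhausted number with zeros, so numbers of different lengths can be read in parallel.\<close>

definition head_bit :: "bool list \<Rightarrow> bool" where
  "head_bit bs = (case bs of [] \<Rightarrow> False | b # _ \<Rightarrow> b)"

lemma unbits_unfold: "unbits bs = of_bool (head_bit bs) + 2 * unbits (tl bs)"
  by (cases bs) (simp_all add: unbits_def head_bit_def)

lemma unbits_bits: "unbits (bits n) = n"
proof (induction n rule: bits.induct)
  case (1 n)
  then show ?case
    by (cases "odd n") (auto simp: bits.simps[of n] unbits_def)
qed

lemma ptime_head_bit: "ptime f \<Longrightarrow> ptime (\<lambda>x. head_bit (f x))"
  unfolding head_bit_def by (intro ptime_intros)

lemma tsize_tl_le: "tsize (tl xs) \<le> tsize xs"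
  by (cases xs) auto

text \<open>One position of a ripple-carry adder. The state holds the carry, the unread bits of both
  summands, and the output with its most significant bit first.\<close>

definition add_step :: "bool \<times> bool list \<times> bool list \<times> bool list \<Rightarrow> bool \<times> bool list \<times> bool list \<times> bool list" where
  "add_step = (\<lambda>(c, as, bs, out). let x = head_bit as; y = head_bit bs in
     (x \<and> y \<or> x \<and> c \<or> y \<and> c, tl as, tl bs, ((x = y) = c) # out))"

lemma add_step_apply:
  "add_step (c, as, bs, out) = (head_bit as \<and> head_bit bs \<or> head_bit as \<and> c \<or> head_bit bs \<and> c,
     tl as, tl bs, ((head_bit as = head_bit bs) = c) # out)"
  by (simp add: add_step_def Let_def)

text \<open>The number represented by output, carry and unread bits together is invariant. The list
  \<open>l\<close> is only a clock.\<close>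

lemma fold_add_step:
  assumes "length as \<le> length l" "length bs \<le> length l"
  shows "case fold (\<lambda>_. add_step) l (c, as, bs, out) of (c', _, _, out') \<Rightarrow>
     fold (\<lambda>b n. of_bool b + 2 * n) out' (of_bool c') =
     fold (\<lambda>b n. of_bool b + 2 * n) out (of_bool c + unbits as + unbits bs)"
  using assms
proof (induction l arbitrary: c as bs out)
  case Nil
  then show ?case by (simp add: unbits_def)
next
  case (Cons a l)
  let ?x = "head_bit as" and ?y = "head_bit bs"
  let ?c = "?x \<and> ?y \<or> ?x \<and> c \<or> ?y \<and> c" and ?o = "(?x = ?y) = c"
  have "of_bool ?o + 2 * (of_bool ?c + unbits (tl as) + unbits (tl bs)) = of_bool c + unbits as + unbits bs"
    unfolding unbits_unfold[of as] unbits_unfold[of bs] by auto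
  with Cons.IH[of "tl as" "tl bs" "?o # out" ?c] Cons.prems show ?case
    by (simp add: add_step_apply)
qed

lemma tsize_nat_bit:
  "tsize (of_bool b + 2 * n :: nat) = (if b \<or> n \<noteq> 0 then of_bool b + tsize n + 1 else 0)"
  unfolding encode_nat_bit by (cases b) auto

lemma nat_bit_exhaust: obtains b k where "(n :: nat) = of_bool b + 2 * k"
proof
  show "n = of_bool (odd n) + 2 * (n div 2)" by (cases "even n") auto
qed

text \<open>The size of a number is its number of binary digits plus its number of ones. In each
  position the output bit plus twice the new carry equals the sum of the incoming bits, so the new
  carry's allowance of 2 is paid for.\<close>

lemma tsize_add_carry: "tsize (of_bool c + m + n :: nat) \<le> tsize m + tsize n + 2 * of_bool c"
proof (induction "m + n" arbitrary: m n c rule: less_induct)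
  case less
  obtain a m' where m: "m = of_bool a + 2 * m'" by (rule nat_bit_exhaust)
  obtain b n' where n: "n = of_bool b + 2 * n'" by (rule nat_bit_exhaust)
  have one: "tsize (1 :: nat) = 2" "tsize (0 :: nat) = 0"
    using tsize_nat_bit[of True 0] tsize_nat_bit[of False 0] by simp_all
  show ?case
  proof (cases "m = 0 \<and> n = 0")
    case True
    with one show ?thesis by (cases c) simp_all
  next
    case False
    define o' d where "o' \<longleftrightarrow> (a = b) = c" and "d \<longleftrightarrow> a \<and> b \<or> a \<and> c \<or> b \<and> c"
    have sum: "of_bool c + m + n = of_bool o' + 2 * (of_bool d + m' + n')"
      unfolding m n o'_def d_def by auto
    have bits: "of_bool o' + 2 * of_bool d = (of_bool a + of_bool b + of_bool c :: nat)"
      unfolding o'_def d_def by auto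
    have "m' + n' < m + n" using False m n by auto
    from less[OF this, of d] have IH: "tsize (of_bool d + m' + n') \<le> tsize m' + tsize n' + 2 * of_bool d" .
    have "tsize (of_bool c + m + n) \<le> of_bool o' + tsize (of_bool d + m' + n') + 1"
      unfolding sum tsize_nat_bit by simp
    moreover have "tsize m' + of_bool a + (if m = 0 then 0 else 1) = tsize m"
      "tsize n' + of_bool b + (if n = 0 then 0 else 1) = tsize n"
      using one(2) unfolding m n tsize_nat_bit by auto
    ultimately show ?thesis using IH bits False by (auto split: if_splits)
  qed
qed

lemma tsize_nat_add: "tsize (m + n :: nat) \<le> tsize m + tsize n"
  using tsize_add_carry[of False] by simp

lemma ptime_of_bits:
  assumes "ptime bs" "ptime n"
  shows "ptime (\<lambda>x. fold (\<lambda>b n. of_bool b + 2 * n) (bs x) (n x) :: nat)"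
  by (intro ptime_fold[where r = "[:2:]"] assms ptime_nat_bit ptime_intros) (simp add: tsize_nat_bit)

lemma ptime_add [ptime_intros]:
  assumes "ptime f" "ptime g" shows "ptime (\<lambda>x. f x + g x :: nat)"
proof -
  \<comment> \<open>The concatenated bits are a clock long enough for both summands; the last carry
    becomes the leading digit.\<close>
  let ?s = "\<lambda>x. fold (\<lambda>_. add_step) (bits (f x) @ bits (g x)) (False, bits (f x), bits (g x), [])"
  have step: "ptime add_step"
    unfolding add_step_def Let_def case_prod_unfold by (intro ptime_head_bit ptime_intros)
  have "ptime ?s"
  proof (intro ptime_fold[where r = "[:3:]"] ptime_comp[OF step] ptime_bits assms ptime_intros)
    fix s :: "bool \<times> bool list \<times> bool list \<times> bool list" and n
    show "tsize (add_step s) \<le> tsize s + poly [:3:] n"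
      using tsize_tl_le[of "fst (snd s)"] tsize_tl_le[of "fst (snd (snd s))"]
      by (cases s) (simp add: add_step_def Let_def encode_bool_def)
  qed
  then have "ptime (\<lambda>x. fold (\<lambda>b n. of_bool b + 2 * n) (snd (snd (snd (?s x)))) (of_bool (fst (?s x)) + 2 * 0) :: nat)"
    by (intro ptime_of_bits ptime_nat_bit ptime_intros)
  moreover have "fold (\<lambda>b n. of_bool b + 2 * n) (snd (snd (snd (?s x)))) (of_bool (fst (?s x)) + 2 * 0) = f x + g x" for x
    using fold_add_step[of "bits (f x)" "bits (f x) @ bits (g x)" "bits (g x)" "[]" False]
    by (simp add: unbits_bits case_prod_unfold)
  ultimately show ?thesis by simp
qed

text \<open>Least significant bits come first, so a later difference overrides earlier ones; the
  flag is the verdict on the positions read so far.\<close>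

definition le_step :: "bool \<times> bool list \<times> bool list \<Rightarrow> bool \<times> bool list \<times> bool list" where
  "le_step = (\<lambda>(r, as, bs).
     (if head_bit as = head_bit bs then r else head_bit bs, tl as, tl bs))"

lemma le_step_apply:
  "le_step (r, as, bs) = (if head_bit as = head_bit bs then r else head_bit bs, tl as, tl bs)"
  by (simp add: le_step_def)

lemma fold_le_step:
  assumes "length as \<le> length l" "length bs \<le> length l"
  shows "fst (fold (\<lambda>_. le_step) l (r, as, bs)) \<longleftrightarrow> unbits as < unbits bs \<or> unbits as = unbits bs \<and> r"
  using assms
proof (induction l arbitrary: r as bs)
  case Nil
  then show ?case by (simp add: unbits_def)
next
  case (Cons a l)
  then have IH: "fst (fold (\<lambda>_. le_step) l (r, tl as, tl bs)) \<longleftrightarrow>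
      unbits (tl as) < unbits (tl bs) \<or> unbits (tl as) = unbits (tl bs) \<and> r" for r
    using Cons.IH[of "tl as" "tl bs" r] by simp
  show ?case
    unfolding unbits_unfold[of as] unbits_unfold[of bs]
    by (cases "head_bit as"; cases "head_bit bs") (auto simp: le_step_apply IH)
qed

lemma ptime_le [ptime_intros]:
  assumes "ptime f" "ptime g" shows "ptime (\<lambda>x. f x \<le> (g x :: nat))"
proof -
  let ?s = "\<lambda>x. fold (\<lambda>_. le_step) (bits (f x) @ bits (g x)) (True, bits (f x), bits (g x))"
  have step: "ptime le_step"
    unfolding le_step_def case_prod_unfold by (intro ptime_head_bit ptime_intros)
  have "ptime ?s"
  proof (intro ptime_fold[where r = "[:1:]"] ptime_comp[OF step] ptime_bits assms ptime_intros)
    fix s :: "bool \<times> bool list \<times> bool list" and n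
    show "tsize (le_step s) \<le> tsize s + poly [:1:] n"
      using tsize_tl_le[of "fst (snd s)"] tsize_tl_le[of "snd (snd s)"]
      by (cases s) (simp add: le_step_def encode_bool_def)
  qed
  then have "ptime (\<lambda>x. fst (?s x))" by (intro ptime_intros)
  moreover have "fst (?s x) \<longleftrightarrow> f x \<le> g x" for x
    by (subst fold_le_step) (auto simp: unbits_bits)
  ultimately show ?thesis by simp
qed

lemma ptime_less [ptime_intros]: "ptime f \<Longrightarrow> ptime g \<Longrightarrow> ptime (\<lambda>x. f x < (g x :: nat))"
  using ptime_not[OF ptime_le, of g f] by (simp add: not_le)

text \<open>Sizes of numbers are subadditive, so each summand enlarges the accumulator by at most
  its own size, as \<open>ptime_fold\<close> demands.\<close>

lemma ptime_sum_list [ptime_intros]: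
  assumes "ptime xs" "ptime (\<lambda>z. f (fst z) (snd z))"
  shows "ptime (\<lambda>c. \<Sum>x\<leftarrow>xs c. f c x :: nat)"
proof -
  obtain q where q: "\<And>z. tsize (f (fst z) (snd z)) \<le> poly q (tsize z)"
    using assms(2) by (rule ptime_tsize) (rule that)
  have "ptime (\<lambda>c. fold (\<lambda>x s. f c x + s) (xs c) 0)"
  proof (intro ptime_fold[where r = "q \<circ>\<^sub>p [:1, 1:]"] ptime_intros assms(1) ptime_comp2[OF assms(2)])
    show "tsize (f c x + s) \<le> tsize s + poly (q \<circ>\<^sub>p [:1, 1:]) (tsize c + tsize x)" for c x s
      using q[of "(c, x)"] tsize_nat_add[of "f c x" s] by (simp add: poly_pcompose)
  qed
  moreover have "fold (\<lambda>x s. f c x + s) l n = (\<Sum>x\<leftarrow>l. f c x) + n" for c l n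
    by (induction l arbitrary: n) auto
  ultimately show ?thesis by simp
qed

lemma ptime_length [ptime_intros]: "ptime xs \<Longrightarrow> ptime (\<lambda>c. length (xs c))"
  using ptime_sum_list[of xs "\<lambda>_ _. 1"] by (simp add: ptime_const sum_list_triv)

text \<open>Lists serve as unary numbers.\<close>

lemma ptime_length_mult [ptime_intros]:
  "ptime xs \<Longrightarrow> ptime f \<Longrightarrow> ptime (\<lambda>c. length (xs c) * f c)"
  using ptime_sum_list[of xs "\<lambda>c _. f c"] by (simp add: ptime_comp[of f] ptime_fst ptime_id sum_list_triv)

section \<open>The algorithm\<close>

subsection \<open>Auction\<close>

text \<open>An entry is a slot together with a word. Two entries with the same key are competing for the
  same word; if words can be reused, this means that they are equal.\<close>

definition key :: "bool \<Rightarrow> 's \<times> 'w \<Rightarrow> 's option \<times> 'w" where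
  "key r e = (if r then Some (fst e) else None, snd e)"

text \<open>The state of the auction consists of the currently accepted entries and of the list of all
  bids made so far. Every bid raises the price of its key by \<open>G\<close>.\<close>

definition price :: "bool \<Rightarrow> nat \<Rightarrow> ('s \<times> 'w) list \<Rightarrow> 's \<times> 'w \<Rightarrow> nat" where
  "price r G H e = (\<Sum>h\<leftarrow>H. if key r h = key r e then G else 0)"

text \<open>Values include the base value \<open>b\<close> of the unextended set, so profit is value
  minus \<open>b\<close> minus price. Writing this with sums avoids truncated subtraction.\<close>

definition bids :: "bool \<Rightarrow> (('s \<times> 'w) \<times> nat) list \<Rightarrow> nat \<Rightarrow> nat \<Rightarrow>
    ('s \<times> 'w) list \<Rightarrow> ('s \<times> 'w) list \<Rightarrow> (('s \<times> 'w) \<times> nat) list" where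
  "bids r V b G F H = filter (\<lambda>v. fst (fst v) \<notin> set (map fst F) \<and> b + price r G H (fst v) < snd v) V"

definition top_bids :: "bool \<Rightarrow> (('s \<times> 'w) \<times> nat) list \<Rightarrow> nat \<Rightarrow> nat \<Rightarrow>
    ('s \<times> 'w) list \<Rightarrow> ('s \<times> 'w) list \<Rightarrow> (('s \<times> 'w) \<times> nat) list" where
  "top_bids r V b G F H = filter (\<lambda>v. \<forall>w \<in> set (bids r V b G F H).
     snd w + price r G H (fst v) \<le> snd v + price r G H (fst w)) (bids r V b G F H)"

text \<open>The former holder of the word loses it, and its slot may bid again later. A state
  without bids is a fixed point, so surplus rounds are harmless.\<close>

definition bid :: "bool \<Rightarrow> (('s \<times> 'w) \<times> nat) list \<Rightarrow> nat \<Rightarrow> nat \<Rightarrow>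
    ('s \<times> 'w) list \<times> ('s \<times> 'w) list \<Rightarrow> ('s \<times> 'w) list \<times> ('s \<times> 'w) list" where
  "bid r V b G s = (case top_bids r V b G (fst s) (snd s) of [] \<Rightarrow> s
     | v # _ \<Rightarrow> (fst v # filter (\<lambda>f. key r f \<noteq> key r (fst v)) (fst s), fst v # snd s))"

definition auction :: "bool \<Rightarrow> (('s \<times> 'w) \<times> nat) list \<Rightarrow> nat \<Rightarrow> nat \<Rightarrow> 't list \<Rightarrow>
    ('s \<times> 'w) list \<times> ('s \<times> 'w) list" where
  "auction r V b G T = fold (\<lambda>_. bid r V b G) T ([], [])"

section \<open>Running time of the auction\<close>

lemma ptime_key [ptime_intros]: "ptime e \<Longrightarrow> ptime (\<lambda>x. key r (e x))"
  unfolding key_def by (intro ptime_intros)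

lemma ptime_price [ptime_intros]:
  assumes "ptime G" "ptime H" "ptime e" shows "ptime (\<lambda>x. price r (G x) (H x) (e x))"
  unfolding price_def by (intro ptime_intros ptime_comp[OF assms(1)] ptime_comp[OF assms(3)] assms(2))

lemma ptime_bids [ptime_intros]:
  assumes "ptime V" "ptime b" "ptime G" "ptime F" "ptime H"
  shows "ptime (\<lambda>x. bids r (V x) (b x) (G x) (F x) (H x))"
  unfolding bids_def by (intro ptime_intros assms[THEN ptime_comp])

lemma ptime_top_bids [ptime_intros]:
  assumes "ptime V" "ptime b" "ptime G" "ptime F" "ptime H"
  shows "ptime (\<lambda>x. top_bids r (V x) (b x) (G x) (F x) (H x))"
  unfolding top_bids_def by (intro ptime_intros assms[THEN ptime_comp])

lemma ptime_bid:
  assumes "ptime V" "ptime b" "ptime G" "ptime s"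
  shows "ptime (\<lambda>x. bid r (V x) (b x) (G x) (s x))"
  unfolding bid_def by (intro ptime_intros assms[THEN ptime_comp])

lemma tsize_filter: "tsize (filter P xs) \<le> tsize xs"
  by (induction xs) auto

lemma top_bids_subset: "set (top_bids r V b G F H) \<subseteq> set V"
  by (auto simp: top_bids_def bids_def)

text \<open>Only an entry of \<open>V\<close> is added, once to each component, so the growth is
  independent of the state.\<close>

lemma tsize_bid: "tsize (bid r V b G s) \<le> tsize s + 2 * tsize V + 2"
proof (cases "top_bids r V b G (fst s) (snd s)")
  case (Cons v vs)
  then have "v \<in> set V" using top_bids_subset[of r V b G "fst s" "snd s"] by auto
  from tsize_member[OF this] show ?thesis
    using tsize_filter[of "\<lambda>f. key r f \<noteq> key r (fst v)" "fst s"] by (simp add: bid_def Cons)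
qed (simp add: bid_def)

lemma ptime_auction [ptime_intros]:
  assumes "ptime V" "ptime b" "ptime G" "ptime T"
  shows "ptime (\<lambda>x. auction r (V x) (b x) (G x) (T x))"
proof -
  obtain q where q: "\<And>x. tsize (V x) \<le> poly q (tsize x)"
    using assms(1) by (rule ptime_tsize) (rule that)
  show ?thesis
    unfolding auction_def
  proof (intro ptime_fold[where r = "smult 2 q + [:2:]"] assms ptime_bid assms[THEN ptime_comp] ptime_intros)
    fix x :: 'a and t :: 'd and s
    have "poly q (tsize x) \<le> poly q (tsize x + tsize t)" by (rule poly_mono_nat) simp
    then show "tsize (bid r (V x) (b x) (G x) s) \<le> tsize s + poly (smult 2 q + [:2:]) (tsize x + tsize t)"
      using tsize_bid[of r "V x" "b x" "G x" s] q[of x] by simp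
  qed
qed

subsection \<open>Weights and feasibility of sets of entries\<close>

type_synonym slot_tuple = "orientation \<times> nat \<times> nat \<times> nat"
type_synonym entry = "slot_tuple \<times> word"

definition next_cell :: "orientation \<Rightarrow> nat \<times> nat \<Rightarrow> nat \<times> nat" where
  "next_cell d p = (if d = Horizontal then (fst p, snd p + 1) else (fst p + 1, snd p))"

definition letters_of :: "entry \<Rightarrow> ((nat \<times> nat) \<times> nat) list" where
  "letters_of e = snd (fold (\<lambda>a s. (next_cell (fst (fst e)) (fst s), (fst s, a) # snd s)) (snd e)
     ((fst (snd (fst e)), fst (snd (snd (fst e)))), []))"

definition letters :: "entry list \<Rightarrow> ((nat \<times> nat) \<times> nat) list" where
  "letters P = fold List.insert (concat (map letters_of P)) []"

text \<open>List access as a fold with a running index; positions outside the list give 0.\<close>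

definition lookup :: "nat list \<Rightarrow> nat \<Rightarrow> nat" where
  "lookup ws a = snd (fold (\<lambda>w s. (fst s + 1, if fst s = a then w else snd s)) ws (0, 0))"

definition list_weight :: "nat list \<Rightarrow> entry list \<Rightarrow> nat" where
  "list_weight ws P = (\<Sum>p\<leftarrow>letters P. lookup ws (snd p))"

definition compatible :: "bool \<Rightarrow> entry list \<Rightarrow> bool" where
  "compatible r P \<longleftrightarrow>
     (\<forall>p \<in> set (letters P). \<forall>q \<in> set (letters P). fst p = fst q \<longrightarrow> p = q) \<and>
     (\<forall>e \<in> set P. \<forall>f \<in> set P. fst e = fst f \<or> key r e = key r f \<longrightarrow> e = f)"

section \<open>Running time of weights and compatibility tests\<close>

lemma ptime_next_cell: "ptime d \<Longrightarrow> ptime p \<Longrightarrow> ptime (\<lambda>x. next_cell (d x) (p x))"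
  unfolding next_cell_def by (intro ptime_intros)

lemma tsize_one: "tsize (1 :: nat) = 2"
  using tsize_nat_bit[of True 0] tsize_nat_bit[of False 0] by simp

lemma tsize_next_cell: "tsize (next_cell d p) \<le> tsize p + 2"
  using tsize_nat_add[of "fst p" 1] tsize_nat_add[of "snd p" 1] by (simp add: next_cell_def tsize_one[simplified])

text \<open>Every step writes down the current cell, which is part of the state, so
  \<open>ptime_fold\<close> does not apply. A cell grows by at most 2 per step, and the potential
  reserves room for one such cell per remaining letter.\<close>

lemma ptime_letters_of [ptime_intros]: "ptime e \<Longrightarrow> ptime (\<lambda>x. letters_of (e x))"
proof (rule ptime_comp[of letters_of])
  let ?\<phi> = "\<lambda>(e :: entry) (l :: nat list) (s :: (nat \<times> nat) \<times> ((nat \<times> nat) \<times> nat) list).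
    tsize s + length l * (tsize (fst s) + 2 * length l + 4) + tsize l"
  show "ptime letters_of"
    unfolding letters_of_def
  proof (intro ptime_snd ptime_fold_potential[where \<phi> = ?\<phi> and r = "[:0, 1:] * [:6, 3:]"] ptime_next_cell ptime_intros)
    fix e :: entry and a :: nat and l :: "nat list" and s :: "(nat \<times> nat) \<times> ((nat \<times> nat) \<times> nat) list"
    let ?N = "tsize (next_cell (fst (fst e)) (fst s))"
    have N: "?N \<le> tsize (fst s) + 2" by (rule tsize_next_cell)
    then have "length l * (?N + 2 * length l + 4) \<le> length l * (tsize (fst s) + 2 * Suc (length l) + 4)"
      by (intro mult_left_mono) auto
    with N show "?\<phi> e l (next_cell (fst (fst e)) (fst s), (fst s, a) # snd s) \<le> ?\<phi> e (a # l) s"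
      by (simp add: algebra_simps)
    have "length l * (tsize (fst s) + 2 * length l + 4) \<le>
        (tsize e + tsize l + tsize s) * (3 * (tsize e + tsize l + tsize s) + 4)"
      using length_le_tsize[of l] by (intro mult_mono) auto
    then show "?\<phi> e l s \<le> poly ([:0, 1:] * [:6, 3:]) (tsize e + tsize l + tsize s)"
      by (simp add: algebra_simps)
  qed simp
qed

lemma ptime_letters [ptime_intros]: "ptime P \<Longrightarrow> ptime (\<lambda>x. letters (P x))"
  unfolding letters_def by (intro ptime_intros)

lemma ptime_lookup [ptime_intros]:
  assumes "ptime ws" "ptime a" shows "ptime (\<lambda>x. lookup (ws x) (a x))"
  unfolding lookup_def
proof (intro ptime_snd ptime_fold[where r = "[:2, 1:]"] ptime_intros assms[THEN ptime_comp])
  show "tsize (fst s + 1, if fst s = a x then w else snd s) \<le> tsize s + poly [:2, 1:] (tsize x + tsize w)"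
    for x w and s :: "nat \<times> nat"
    using tsize_nat_add[of "fst s" 1] by (auto simp: tsize_one[simplified])
qed

lemma ptime_list_weight [ptime_intros]:
  assumes "ptime ws" "ptime P" shows "ptime (\<lambda>x. list_weight (ws x) (P x))"
  unfolding list_weight_def by (intro ptime_intros assms[THEN ptime_comp])

lemma ptime_compatible [ptime_intros]:
  assumes "ptime P" shows "ptime (\<lambda>x. compatible r (P x))"
  unfolding compatible_def by (intro ptime_intros assms[THEN ptime_comp])

subsection \<open>Partial enumeration\<close>

definition entries :: "slot_tuple list \<Rightarrow> word list \<Rightarrow> entry list" where
  "entries ss D = concat (map (\<lambda>s. map (\<lambda>u. (s, u)) (filter (\<lambda>u. length u = snd (snd (snd s))) D)) ss)"

fun lists_upto :: "nat \<Rightarrow> 'a list \<Rightarrow> 'a list list" where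
  "lists_upto 0 xs = [[]]"
| "lists_upto (Suc k) xs = [] # concat (map (\<lambda>l. map (\<lambda>x. x # l) xs) (lists_upto k xs))"

text \<open>Conflicts with \<open>P\<close> are excluded here. Conflicts between two of these
  entries are left to the auction: within one orientation they concern only slots and keys.\<close>

definition admissible :: "bool \<Rightarrow> entry list \<Rightarrow> orientation \<Rightarrow> entry list \<Rightarrow> entry list" where
  "admissible r E d P = filter (\<lambda>e. fst (fst e) = d \<and> fst e \<notin> set (map fst P) \<and> compatible r (e # P)) E"

definition heaviest :: "nat list \<Rightarrow> entry list list \<Rightarrow> entry list" where
  "heaviest ws Ps = (case filter (\<lambda>P. \<forall>Q \<in> set Ps. list_weight ws Q \<le> list_weight ws P) Ps of
     [] \<Rightarrow> [] | P # _ \<Rightarrow> P)"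

text \<open>The values are scaled by the length of the list \<open>C\<close>. No admissible entry gains more than
  \<open>length C * G\<close>, so there are at most \<open>length C\<close> bids for every key.\<close>

definition extend :: "bool \<Rightarrow> nat list \<Rightarrow> bool list \<Rightarrow> entry list \<Rightarrow> orientation \<Rightarrow> entry list \<Rightarrow> entry list" where
  "extend r ws C E d P =
     fst (auction r (map (\<lambda>e. (e, length C * list_weight ws (e # P))) (admissible r E d P))
       (length C * list_weight ws P)
       (list_weight ws (heaviest ws (map (\<lambda>e. e # P) (admissible r E d P))))
       (True # concat (map (\<lambda>_. map (\<lambda>_. True) (admissible r E d P)) C))) @ P"

definition results :: "bool \<Rightarrow> nat \<Rightarrow> nat list \<Rightarrow> bool list \<Rightarrow> entry list \<Rightarrow> entry list list" where
  "results r k ws C E = concat (map (\<lambda>P. [extend r ws C E Horizontal P, extend r ws C E Vertical P])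
     (filter (compatible r) (lists_upto k E)))"

text \<open>With n slots, the unary list of \<open>True\<close> has length k n^2. An auction error
  of n times the optimum on this scale is a fraction 1/(k n) of the optimum.\<close>

definition best_entries :: "bool \<Rightarrow> nat \<Rightarrow> slot_tuple list \<Rightarrow> word list \<Rightarrow> nat list \<Rightarrow> entry list" where
  "best_entries r k ss D ws = heaviest ws (results r k ws
     (concat (map (\<lambda>_. concat (map (\<lambda>_. replicate k True) ss)) ss)) (entries ss D))"

definition word_at :: "entry list \<Rightarrow> slot_tuple \<Rightarrow> word option" where
  "word_at P s = (case filter (\<lambda>e. fst e = s) P of [] \<Rightarrow> None | e # _ \<Rightarrow> Some (snd e))"

definition solve :: "bool \<Rightarrow> nat \<Rightarrow> slot_tuple list \<Rightarrow> word list \<Rightarrow> nat list \<Rightarrow> solution" where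
  "solve r k ss D ws = map (word_at (best_entries r k ss D ws)) ss"

section \<open>Running time of the whole algorithm\<close>

lemma ptime_entries [ptime_intros]:
  assumes "ptime ss" "ptime D" shows "ptime (\<lambda>x. entries (ss x) (D x))"
  unfolding entries_def by (intro ptime_intros assms[THEN ptime_comp])

text \<open>\<open>k\<close> is not part of the input: there is one program for each
  \<open>k\<close>, obtained by induction.\<close>

lemma ptime_lists_upto [ptime_intros]:
  assumes "ptime xs" shows "ptime (\<lambda>x. lists_upto k (xs x))"
proof (induction k)
  case (Suc k)
  then show ?case by (simp, intro ptime_intros assms[THEN ptime_comp])
qed (simp add: ptime_const)

lemma ptime_admissible [ptime_intros]:
  assumes "ptime E" "ptime d" "ptime P" shows "ptime (\<lambda>x. admissible r (E x) (d x) (P x))"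
  unfolding admissible_def by (intro ptime_intros assms[THEN ptime_comp])

lemma ptime_heaviest [ptime_intros]:
  assumes "ptime ws" "ptime Ps" shows "ptime (\<lambda>x. heaviest (ws x) (Ps x))"
  unfolding heaviest_def by (intro ptime_intros assms[THEN ptime_comp])

lemma ptime_extend [ptime_intros]:
  assumes "ptime ws" "ptime C" "ptime E" "ptime d" "ptime P"
  shows "ptime (\<lambda>x. extend r (ws x) (C x) (E x) (d x) (P x))"
  unfolding extend_def by (intro ptime_intros assms[THEN ptime_comp])

lemma ptime_results [ptime_intros]:
  assumes "ptime ws" "ptime C" "ptime E"
  shows "ptime (\<lambda>x. results r k (ws x) (C x) (E x))"
  unfolding results_def by (intro ptime_intros assms[THEN ptime_comp])

lemma ptime_best_entries [ptime_intros]: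
  assumes "ptime ss" "ptime D" "ptime ws"
  shows "ptime (\<lambda>x. best_entries r k (ss x) (D x) (ws x))"
  unfolding best_entries_def by (intro ptime_intros assms[THEN ptime_comp])

lemma ptime_word_at [ptime_intros]:
  assumes "ptime P" "ptime s" shows "ptime (\<lambda>x. word_at (P x) (s x))"
  unfolding word_at_def by (intro ptime_intros assms[THEN ptime_comp])

lemma ptime_solve:
  assumes "ptime ss" "ptime D" "ptime ws" shows "ptime (\<lambda>x. solve r k (ss x) (D x) (ws x))"
  unfolding solve_def by (intro ptime_intros assms[THEN ptime_comp])

section \<open>Correctness\<close>

subsection \<open>Auction\<close>

lemma ex_max_nat_diff:
  fixes f g :: "'a \<Rightarrow> nat"
  assumes "finite A" "A \<noteq> {}"
  obtains x where "x \<in> A" "\<And>y. y \<in> A \<Longrightarrow> f y + g x \<le> f x + g y"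
proof -
  let ?h = "\<lambda>x. int (f x) - int (g x)"
  have "Max (?h ` A) \<in> ?h ` A" using assms by (intro Max_in) auto
  then obtain x where x: "x \<in> A" "?h x = Max (?h ` A)" by auto
  show thesis
  proof (rule that[OF x(1)])
    fix y assume "y \<in> A"
    then have "?h y \<le> ?h x" using assms(1) unfolding x(2) by (intro Max_ge) auto
    then show "f y + g x \<le> f x + g y" by linarith
  qed
qed

text \<open>\<open>N * G\<close> bounds the profit at price zero, so after \<open>N\<close> bids a
  key is too expensive for every entry.\<close>

locale auction_setting =
  fixes r :: bool and E :: "('s \<times> 'w) list" and val :: "'s \<times> 'w \<Rightarrow> nat" and b G N :: nat
  assumes val_le: "e \<in> set E \<Longrightarrow> val e \<le> b + N * G"
begin

abbreviation V :: "(('s \<times> 'w) \<times> nat) list" where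
  "V \<equiv> map (\<lambda>e. (e, val e)) E"

abbreviation pr :: "('s \<times> 'w) list \<Rightarrow> 's \<times> 'w \<Rightarrow> nat" where
  "pr \<equiv> price r G"

text \<open>Approximate complementary slackness: exactly the keys ever bid on are held by an
  accepted entry, and accepted entries are, up to one increment \<open>G\<close>, profitable and
  best for their slot.\<close>

definition invar :: "('s \<times> 'w) list \<Rightarrow> ('s \<times> 'w) list \<Rightarrow> bool" where
  "invar F H \<longleftrightarrow> set F \<subseteq> set E \<and> set H \<subseteq> set E \<and> distinct (map fst F) \<and> inj_on (key r) (set F) \<and>
     key r ` set F = key r ` set H \<and>
     (\<forall>e \<in> set F. b + pr H e \<le> val e + G) \<and>
     (\<forall>e \<in> set F. \<forall>f \<in> set E. fst e = fst f \<longrightarrow> val f + pr H e \<le> val e + pr H f + G) \<and>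
     (\<forall>k. length (filter (\<lambda>h. key r h = k) H) \<le> N)"

lemma pr_Cons: "pr (h # H) e = pr H e + (if key r h = key r e then G else 0)"
  by (simp add: price_def)

lemma pr_eq_mult: "pr H e = length (filter (\<lambda>h. key r h = key r e) H) * G"
  by (induction H) (auto simp: price_def)

lemma top_bids_eq_Nil_iff: "top_bids r V b G F H = [] \<longleftrightarrow> bids r V b G F H = []"
proof
  assume top: "top_bids r V b G F H = []"
  show "bids r V b G F H = []"
  proof (rule ccontr)
    assume "bids r V b G F H \<noteq> []"
    then obtain v where "v \<in> set (bids r V b G F H)"
      "\<And>w. w \<in> set (bids r V b G F H) \<Longrightarrow> snd w + pr H (fst v) \<le> snd v + pr H (fst w)"
      using ex_max_nat_diff[of "set (bids r V b G F H)" snd "\<lambda>v. pr H (fst v)"] by auto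
    then have "v \<in> set (top_bids r V b G F H)" by (auto simp: top_bids_def)
    with top show False by simp
  qed
qed (simp add: top_bids_def)

text \<open>Only the price of the new entry's key rises. The previous holder of this key is dropped,
  so the other accepted entries keep their profits, while their alternatives can only become
  dearer.\<close>

lemma invar_bid:
  assumes inv: "invar F H" and step: "bid r V b G (F, H) = (F', H')"
  shows "invar F' H'" and "length H' = length H + (if bids r V b G F H = [] then 0 else 1)"
proof -
  have "invar F' H' \<and> length H' = length H + (if bids r V b G F H = [] then 0 else 1)"
  proof (cases "top_bids r V b G F H")
    case Nil
    then have "bids r V b G F H = []" by (simp add: top_bids_eq_Nil_iff)
    then show ?thesis using Nil inv step by (simp add: bid_def)
  next
    case (Cons v vs)
    define e where "e = fst v"
    have F': "F' = e # filter (\<lambda>f. key r f \<noteq> key r e) F" and H': "H' = e # H"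
      using step by (auto simp: bid_def Cons e_def)
    have v: "v \<in> set (top_bids r V b G F H)" by (simp add: Cons)
    then have "v \<in> set (bids r V b G F H)" by (simp add: top_bids_def)
    then have e: "e \<in> set E" "fst e \<notin> fst ` set F" "b + pr H e < val e" and snd_v: "snd v = val e"
      by (auto simp: bids_def e_def)
    \<comment> \<open>Among the entries of this free slot, those that bid are dominated by the
      choice of \<open>v\<close>; the others have no positive profit, whereas \<open>e\<close>
      has.\<close>
    have top: "val f + pr H e \<le> val e + pr H f" if "f \<in> set E" "fst e = fst f" for f
    proof (cases "b + pr H f < val f")
      case True
      with that e(2) have "(f, val f) \<in> set (bids r V b G F H)" by (auto simp: bids_def)
      with v show ?thesis by (auto simp: top_bids_def e_def snd_v[unfolded e_def])
    next
      case False
      with e(3) show ?thesis by simp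
    qed
    have le: "pr H f \<le> pr H' f" for f by (simp add: H' pr_Cons)
    have eq: "pr H' f = pr H f" if "key r f \<noteq> key r e" for f using that by (auto simp: H' pr_Cons)
    have pr_e: "pr H' e = pr H e + G" by (simp add: H' pr_Cons)
    \<comment> \<open>A positive profit leaves room for one more bid on this key.\<close>
    have "pr H e < N * G" using e(1,3) val_le[of e] by linarith
    then have count: "length (filter (\<lambda>h. key r h = key r e) H) < N" by (simp add: pr_eq_mult)
    have "invar F' H'"
      unfolding invar_def
    proof (intro conjI ballI impI allI)
      show "set F' \<subseteq> set E" "set H' \<subseteq> set E" using inv e(1) by (auto simp: F' H' invar_def)
      show "distinct (map fst F')"
        using inv e(2) by (auto simp: F' invar_def distinct_map_filter)
      show "inj_on (key r) (set F')"
        using inv by (auto simp: F' invar_def inj_on_def)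
      have "key r ` set F' = insert (key r e) (key r ` set F)" by (auto simp: F')
      then show "key r ` set F' = key r ` set H'" using inv by (simp add: H' invar_def)
      show "b + pr H' f \<le> val f + G" if "f \<in> set F'" for f
      proof (cases "f = e")
        case True
        with e(3) pr_e show ?thesis by simp
      next
        case False
        with that have "f \<in> set F" "key r f \<noteq> key r e" by (auto simp: F')
        with inv eq[of f] show ?thesis by (simp add: invar_def)
      qed
      show "val g + pr H' f \<le> val f + pr H' g + G" if "f \<in> set F'" "g \<in> set E" "fst f = fst g" for f g
      proof (cases "f = e")
        case True
        with top[of g] that pr_e le[of g] show ?thesis by simp
      next
        case False
        with that(1) have "f \<in> set F" "key r f \<noteq> key r e" by (auto simp: F')
        with inv that(2,3) have "val g + pr H f \<le> val f + pr H g + G" by (auto simp: invar_def)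
        with le[of g] eq[OF \<open>key r f \<noteq> key r e\<close>] show ?thesis by simp
      qed
      show "length (filter (\<lambda>h. key r h = k) H') \<le> N" for k
      proof -
        have "length (filter (\<lambda>h. key r h = k) H) \<le> N" using inv unfolding invar_def by blast
        with count show ?thesis by (cases "key r e = k") (simp_all add: H' Suc_le_eq)
      qed
    qed
    moreover have "bids r V b G F H \<noteq> []" using Cons top_bids_eq_Nil_iff by force
    ultimately show ?thesis by (simp add: H')
  qed
  then show "invar F' H'" "length H' = length H + (if bids r V b G F H = [] then 0 else 1)" by auto
qed

text \<open>At most \<open>N\<close> bids fall on each of at most \<open>length E\<close>
  keys.\<close>

lemma invar_length:
  assumes "invar F H" shows "length H \<le> N * length E"
proof -
  have count: "count_list (map (key r) H) k = length (filter (\<lambda>h. key r h = k) H)" for k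
    by (simp add: count_list_eq_length_filter filter_map o_def eq_commute)
  have le: "length (filter (\<lambda>h. key r h = k) H) \<le> N" for k
    using assms unfolding invar_def by blast
  have "length H = (\<Sum>k \<in> key r ` set H. count_list (map (key r) H) k)"
    using sum_count_set[of "map (key r) H" "key r ` set H"] by simp
  also have "\<dots> \<le> card (key r ` set H) * N"
    using sum_bounded_above[of "key r ` set H" "count_list (map (key r) H)" N] le by (simp add: count)
  also have "card (key r ` set H) \<le> card (set (map (key r) E))"
    using assms by (intro card_mono) (auto simp: invar_def)
  also have "\<dots> \<le> length E" using card_length[of "map (key r) E"] by simp
  finally show ?thesis by (simp add: mult.commute)
qed

lemma auction_result:
  assumes T: "N * length E < length T" and "auction r V b G T = (F, H)"
  shows "invar F H" and "bids r V b G F H = []"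
proof -
  \<comment> \<open>While bids remain, each round lengthens the history by one; a run that never
    stalls would exceed the bound of \<open>invar_length\<close>.\<close>
  have "case fold (\<lambda>_. bid r V b G) T (F0, H0) of (F, H) \<Rightarrow>
      invar F H \<and> (bids r V b G F H = [] \<or> length H = length H0 + length T)" if "invar F0 H0" for F0 H0
    using that
  proof (induction T arbitrary: F0 H0)
    case (Cons t T)
    obtain F1 H1 where 1: "bid r V b G (F0, H0) = (F1, H1)" by fastforce
    show ?case
    proof (cases "bids r V b G F0 H0 = []")
      case True
      then have "bid r V b G (F0, H0) = (F0, H0)" by (simp add: bid_def top_bids_def)
      moreover from this have "fold (\<lambda>_. bid r V b G) T (F0, H0) = (F0, H0)" for T :: "'a list"
        by (induction T) auto
      ultimately show ?thesis using True Cons.prems by simp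
    next
      case False
      with Cons.IH[OF invar_bid(1)[OF Cons.prems 1]] invar_bid(2)[OF Cons.prems 1] show ?thesis
        by (auto simp: 1 split: prod.splits)
    qed
  qed auto
  moreover have "invar [] []" by (simp add: invar_def)
  ultimately have "invar F H \<and> (bids r V b G F H = [] \<or> length H = length T)"
    using assms(2) unfolding auction_def by fastforce
  with invar_length[of F H] T show "invar F H" "bids r V b G F H = []" by auto
qed

text \<open>Weak duality for the assignment problem, with the final prices as dual solution.\<close>

lemma auction_near_optimal:
  assumes inv: "invar F H" and final: "bids r V b G F H = []"
    and A: "A \<subseteq> set E" "inj_on fst A" "inj_on (key r) A"
  shows "(\<Sum>e\<in>A. int (val e) - int b) \<le> (\<Sum>e\<in>set F. int (val e) - int b) + int (length F * G)"
proof -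
  let ?p = "\<lambda>e. int (pr H e)" and ?g = "\<lambda>e. int (val e) - int b"
  have finA: "finite A" using A(1) finite_subset by blast
  have fst_F: "inj_on fst (set F)" and distinct_F: "distinct F"
    using inv by (auto simp: invar_def distinct_map)
  \<comment> \<open>The dual variable of a matched slot: the profit of its accepted entry plus the
    slack \<open>G\<close>. Unmatched slots get 0, as none of their entries is profitable at the
    final prices.\<close>
  define h where "h s = ?g (the_inv_into (set F) fst s) - ?p (the_inv_into (set F) fst s) + int G" for s
  have h: "h (fst f) = ?g f - ?p f + int G" if "f \<in> set F" for f
    using that fst_F by (simp add: h_def the_inv_into_f_f)
  have h_nonneg: "0 \<le> h s" if "s \<in> fst ` set F" for s
  proof -
    from that obtain f where f: "f \<in> set F" "s = fst f" by auto
    with inv have "b + pr H f \<le> val f + G" by (simp add: invar_def)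
    with h[OF f(1)] f(2) show ?thesis by simp
  qed
  have g_le: "?g e - ?p e \<le> (if fst e \<in> fst ` set F then h (fst e) else 0)" if "e \<in> A" for e
  proof (cases "fst e \<in> fst ` set F")
    case True
    then obtain f where f: "f \<in> set F" "fst e = fst f" by auto
    with inv that A(1) have "val e + pr H f \<le> val f + pr H e + G" by (auto simp: invar_def)
    with f h[OF f(1)] show ?thesis by simp
  next
    case False
    with that A(1) have "(e, val e) \<notin> set (bids r V b G F H)" "e \<in> set E" using final by auto
    with False show ?thesis by (auto simp: bids_def not_less)
  qed
  have "(\<Sum>e\<in>A. ?g e - ?p e) \<le> (\<Sum>e\<in>A. if fst e \<in> fst ` set F then h (fst e) else 0)"
    by (intro sum_mono g_le)
  also have "\<dots> = (\<Sum>s\<in>fst ` A. if s \<in> fst ` set F then h s else 0)"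
    using A(2) by (simp add: sum.reindex)
  also have "\<dots> = (\<Sum>s\<in>fst ` A \<inter> fst ` set F. h s)"
    using finA by (simp add: sum.inter_restrict)
  also have "\<dots> \<le> (\<Sum>s\<in>fst ` set F. h s)"
    using h_nonneg by (intro sum_mono2) auto
  also have "\<dots> = (\<Sum>f\<in>set F. ?g f - ?p f + int G)"
    using fst_F h by (simp add: sum.reindex)
  also have "\<dots> = (\<Sum>f\<in>set F. ?g f) - (\<Sum>f\<in>set F. ?p f) + int (length F * G)"
    using distinct_F by (simp add: sum.distrib sum_subtractf distinct_card)
  finally have 1: "(\<Sum>e\<in>A. ?g e - ?p e) \<le> \<dots>" .
  \<comment> \<open>Prices as a function of the key. Keys that nobody holds have price 0, so the
    prices of \<open>A\<close> sum to at most those of the accepted entries.\<close>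
  define q where "q k = int (length (filter (\<lambda>h. key r h = k) H) * G)" for k
  have q: "?p e = q (key r e)" for e by (simp add: q_def pr_eq_mult)
  have q_0: "q k = 0" if "k \<notin> key r ` set F" for k
    using that inv by (auto simp: q_def invar_def filter_empty_conv)
  have "(\<Sum>e\<in>A. ?p e) = (\<Sum>k\<in>key r ` A. q k)"
    using A(3) by (simp add: sum.reindex q)
  also have "\<dots> = (\<Sum>k\<in>key r ` A \<inter> key r ` set F. q k)"
    using finA q_0 by (intro sum.mono_neutral_right) auto
  also have "\<dots> \<le> (\<Sum>k\<in>key r ` set F. q k)"
    by (intro sum_mono2) (auto simp: q_def)
  also have "\<dots> = (\<Sum>e\<in>set F. ?p e)"
    using inv by (subst sum.reindex) (simp_all add: q invar_def)
  finally have 2: "(\<Sum>e\<in>A. ?p e) \<le> \<dots>" .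
  from 1 2 show ?thesis by (simp add: sum_subtractf)
qed

end

subsection \<open>Extending a consistent set of entries\<close>

text \<open>\<open>cover\<close>, \<open>total\<close> and \<open>consistent\<close> are the
  counterparts for sets of \<open>letters\<close>, \<open>list_weight\<close> and
  \<open>compatible\<close>; the combinatorial argument is carried out with them.\<close>

definition cover :: "entry set \<Rightarrow> ((nat \<times> nat) \<times> nat) set" where
  "cover X = (\<Union>e\<in>X. set (letters_of e))"

definition total :: "nat list \<Rightarrow> ((nat \<times> nat) \<times> nat) set \<Rightarrow> nat" where
  "total ws L = (\<Sum>p\<in>L. lookup ws (snd p))"

definition consistent :: "bool \<Rightarrow> entry set \<Rightarrow> bool" where
  "consistent r X \<longleftrightarrow> (\<forall>p \<in> cover X. \<forall>q \<in> cover X. fst p = fst q \<longrightarrow> p = q) \<and>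
     (\<forall>e \<in> X. \<forall>f \<in> X. fst e = fst f \<or> key r e = key r f \<longrightarrow> e = f)"

lemma set_letters: "set (letters P) = cover (set P)"
  using set_union[of "concat (map letters_of P)" "[]"]
  by (simp add: letters_def cover_def List.union_def)

lemma distinct_letters: "distinct (letters P)"
  using distinct_union[of "concat (map letters_of P)" "[]"]
  by (simp add: letters_def List.union_def)

lemma list_weight_eq_total: "list_weight ws P = total ws (cover (set P))"
  by (simp add: list_weight_def total_def sum_list_distinct_conv_sum_set distinct_letters set_letters)

lemma compatible_iff_consistent: "compatible r P \<longleftrightarrow> consistent r (set P)"
  by (simp add: compatible_def consistent_def set_letters)

lemma consistent_subset: "consistent r Y \<Longrightarrow> X \<subseteq> Y \<Longrightarrow> consistent r X"
  unfolding consistent_def cover_def by blast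

lemma consistent_inj_on: "consistent r X \<Longrightarrow> inj_on fst X \<and> inj_on (key r) X"
  unfolding consistent_def inj_on_def by blast

lemma finite_cover: "finite X \<Longrightarrow> finite (cover X)"
  by (simp add: cover_def)

lemma cover_insert: "cover (insert e X) = cover X \<union> set (letters_of e)"
  by (auto simp: cover_def)

lemma cover_Un: "cover (X \<union> Y) = cover X \<union> cover Y"
  by (auto simp: cover_def)

lemma total_mono: "finite L' \<Longrightarrow> L \<subseteq> L' \<Longrightarrow> total ws L \<le> total ws L'"
  unfolding total_def by (rule sum_mono2) auto

lemma total_Un_Diff: "finite L \<Longrightarrow> finite L' \<Longrightarrow> total ws (L \<union> L') = total ws L + total ws (L' - L)"
  unfolding total_def by (subst sum.union_disjoint[symmetric]) (auto intro: sum.cong)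

lemma heaviest_props:
  assumes "Ps \<noteq> []"
  shows "heaviest ws Ps \<in> set Ps" "Q \<in> set Ps \<Longrightarrow> list_weight ws Q \<le> list_weight ws (heaviest ws Ps)"
proof -
  let ?B = "filter (\<lambda>P. \<forall>Q \<in> set Ps. list_weight ws Q \<le> list_weight ws P) Ps"
  obtain P where "P \<in> set Ps" "\<And>Q. Q \<in> set Ps \<Longrightarrow> list_weight ws Q + 0 \<le> list_weight ws P + 0"
    using ex_max_nat_diff[of "set Ps" "list_weight ws" "\<lambda>_. 0"] assms by auto
  then have "P \<in> set ?B" by simp
  then have "heaviest ws Ps \<in> set ?B"
    by (cases ?B) (auto simp: heaviest_def simp del: set_filter)
  then show "heaviest ws Ps \<in> set Ps" "Q \<in> set Ps \<Longrightarrow> list_weight ws Q \<le> list_weight ws (heaviest ws Ps)"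
    by auto
qed

lemma set_lists_upto: "set (lists_upto k xs) = {l. length l \<le> k \<and> set l \<subseteq> set xs}"
proof (induction k)
  case (Suc k)
  show ?case
  proof (intro set_eqI)
    fix l
    show "l \<in> set (lists_upto (Suc k) xs) \<longleftrightarrow> l \<in> {l. length l \<le> Suc k \<and> set l \<subseteq> set xs}"
      by (cases l) (auto simp: Suc)
  qed
qed auto

text \<open>Isolates what the approximation argument uses of the grid.\<close>

locale crossword_entries =
  fixes r :: bool and ws :: "nat list" and E :: "entry list" and n :: nat
  assumes disjoint: "e \<in> set E \<Longrightarrow> f \<in> set E \<Longrightarrow> fst e \<noteq> fst f \<Longrightarrow> fst (fst e) = fst (fst f) \<Longrightarrow>
      fst ` set (letters_of e) \<inter> fst ` set (letters_of f) = {}"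
    and card_slots: "card (fst ` set E) \<le> n"
begin

text \<open>Entries of \<open>F\<close> cannot conflict with each other: their slots and keys
  differ, and slots of equal orientation are disjoint. So testing each of them separately against
  \<open>P\<close> is enough.\<close>

lemma consistent_Un:
  assumes P: "consistent r P" and F: "F \<subseteq> set E" "inj_on fst F" "inj_on (key r) F"
    and opt: "\<And>e. e \<in> F \<Longrightarrow> fst (fst e) = d" "\<And>e. e \<in> F \<Longrightarrow> consistent r (insert e P)"
  shows "consistent r (F \<union> P)"
  unfolding consistent_def
proof (intro conjI ballI impI)
  have one: "p = q" if "e \<in> F" "p \<in> cover (insert e P)" "q \<in> cover (insert e P)" "fst p = fst q" for e p q
    using opt(2)[OF that(1)] that(2-) unfolding consistent_def by blast
  fix p q assume pq: "p \<in> cover (F \<union> P)" "q \<in> cover (F \<union> P)" "fst p = fst q"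
  have cover_cases: "x \<in> cover P \<or> (\<exists>e\<in>F. x \<in> set (letters_of e))" if "x \<in> cover (F \<union> P)" for x
    using that by (auto simp: cover_def)
  from cover_cases[OF pq(1)] cover_cases[OF pq(2)] consider "p \<in> cover P" "q \<in> cover P" | e where "e \<in> F" "p \<in> set (letters_of e)" "q \<in> cover P"
    | e where "e \<in> F" "q \<in> set (letters_of e)" "p \<in> cover P"
    | e f where "e \<in> F" "f \<in> F" "p \<in> set (letters_of e)" "q \<in> set (letters_of f)"
    by blast
  then show "p = q"
  proof cases
    case 1
    with P pq(3) show ?thesis unfolding consistent_def by blast
  next
    case (2 e)
    with one[of e p q] pq(3) show ?thesis by (simp add: cover_insert)
  next
    case (3 e)
    with one[of e p q] pq(3) show ?thesis by (simp add: cover_insert)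
  next
    case (4 e f)
    have "e = f"
    proof (rule ccontr)
      assume "e \<noteq> f"
      with F(2) 4 have "fst e \<noteq> fst f" by (auto dest: inj_onD)
      with disjoint[of e f] F(1) 4 opt(1)[of e] opt(1)[of f]
      have "fst ` set (letters_of e) \<inter> fst ` set (letters_of f) = {}" by auto
      with 4 pq(3) show False by (metis disjoint_iff imageI)
    qed
    with one[of e p q] pq(3) 4 show ?thesis by (simp add: cover_insert)
  qed
next
  fix e f assume ef: "e \<in> F \<union> P" "f \<in> F \<union> P" "fst e = fst f \<or> key r e = key r f"
  consider "e \<in> F" "f \<in> F" | "e \<in> P" "f \<in> P" | "e \<in> F" "f \<in> P" | "e \<in> P" "f \<in> F" using ef by blast
  then show "e = f"
  proof cases
    case 1
    with ef(3) F(2,3) show ?thesis by (auto dest: inj_onD)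
  next
    case 2
    with ef(3) P show ?thesis unfolding consistent_def by blast
  next
    case 3
    with ef(3) opt(2)[of e] show ?thesis unfolding consistent_def by blast
  next
    case 4
    with ef(3) opt(2)[of f] show ?thesis unfolding consistent_def by blast
  qed
qed

lemma total_UNION:
  assumes F: "F \<subseteq> set E" "inj_on fst F" "\<And>e. e \<in> F \<Longrightarrow> fst (fst e) = d"
  shows "total ws (cover F - L) = (\<Sum>e\<in>F. total ws (set (letters_of e) - L))"
proof -
  have fin: "finite F" using F(1) finite_subset by blast
  have eq: "cover F - L = (\<Union>e\<in>F. set (letters_of e) - L)" by (auto simp: cover_def)
  have disj: "(set (letters_of e) - L) \<inter> (set (letters_of f) - L) = {}"
    if "e \<in> F" "f \<in> F" "e \<noteq> f" for e f
  proof -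
    have "fst e \<noteq> fst f" using F(2) that by (auto dest: inj_onD)
    with disjoint[of e f] F(1) F(3)[of e] F(3)[of f] that
    have "fst ` set (letters_of e) \<inter> fst ` set (letters_of f) = {}" by auto
    then show ?thesis by blast
  qed
  show ?thesis
    unfolding total_def eq by (rule sum.UNION_disjoint) (use fin disj in auto)
qed

text \<open>Distinct entries of \<open>F\<close> add distinct cells to those of \<open>P\<close>, so
  gains are additive; this makes the extension an assignment problem.\<close>

lemma total_extension:
  assumes "finite P" "F \<subseteq> set E" "inj_on fst F" "\<And>e. e \<in> F \<Longrightarrow> fst (fst e) = d"
  shows "int (total ws (cover (F \<union> P))) = int (total ws (cover P)) +
    (\<Sum>e\<in>F. int (total ws (cover (insert e P))) - int (total ws (cover P)))"
proof -
  have "finite F" using assms(2) finite_subset by blast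
  then have "total ws (cover (F \<union> P)) = total ws (cover P) + total ws (cover F - cover P)"
    using assms(1) by (subst Un_commute) (simp add: cover_Un total_Un_Diff finite_cover)
  moreover have "total ws (cover (insert e P)) = total ws (cover P) + total ws (set (letters_of e) - cover P)" for e
    using assms(1) by (simp add: cover_insert total_Un_Diff finite_cover)
  ultimately show ?thesis using total_UNION[OF assms(2-4)] by simp
qed

text \<open>The auction loses at most \<open>G\<close> for each of at most \<open>n\<close> matched
  slots, and \<open>G\<close> is at most \<open>OPT\<close> because it is the weight of a consistent
  set.\<close>

lemma extend_props:
  fixes OPT :: nat
  assumes P: "consistent r (set P)" "set P \<subseteq> set E"
    and OPT: "\<And>X. X \<subseteq> set E \<Longrightarrow> consistent r X \<Longrightarrow> total ws (cover X) \<le> OPT"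
  shows "set (extend r ws C E d P) \<subseteq> set E" "consistent r (set (extend r ws C E d P))"
    and "A \<subseteq> set E \<Longrightarrow> (\<And>e. e \<in> A \<Longrightarrow> fst (fst e) = d \<and> fst e \<notin> fst ` set P) \<Longrightarrow> consistent r (A \<union> set P) \<Longrightarrow>
      length C * total ws (cover (A \<union> set P)) \<le>
      length C * total ws (cover (set (extend r ws C E d P))) + n * OPT"
proof -
  define O' where "O' = admissible r E d P"
  define N where "N = length C"
  define G where "G = list_weight ws (heaviest ws (map (\<lambda>e. e # P) O'))"
  define val where "val e = N * list_weight ws (e # P)" for e
  define b where "b = N * list_weight ws P"
  have O': "e \<in> set E" "fst (fst e) = d" "fst e \<notin> fst ` set P" "consistent r (insert e (set P))"
    if "e \<in> set O'" for e
    using that by (auto simp: O'_def admissible_def compatible_iff_consistent)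
  have G_ge: "list_weight ws (e # P) \<le> G" if "e \<in> set O'" for e
    unfolding G_def using that by (intro heaviest_props(2)) auto
  have G_le: "G \<le> OPT"
  proof (cases "O' = []")
    \<comment> \<open>Without admissible entries, \<open>heaviest\<close> falls back to
      \<open>[]\<close>, so \<open>G\<close> is 0.\<close>
    case True
    then show ?thesis using OPT[of "{}"] by (simp add: G_def heaviest_def list_weight_eq_total consistent_def cover_def)
  next
    case False
    then have "heaviest ws (map (\<lambda>e. e # P) O') \<in> set (map (\<lambda>e. e # P) O')"
      by (intro heaviest_props(1)) simp
    then obtain e where "e \<in> set O'" "heaviest ws (map (\<lambda>e. e # P) O') = e # P" by auto
    with O'[of e] P(2) OPT[of "insert e (set P)"] show ?thesis
      by (simp add: G_def list_weight_eq_total)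
  qed
  interpret auction_setting r O' val b G N
  proof
    fix e assume "e \<in> set O'"
    then have "N * list_weight ws (e # P) \<le> N * G" using G_ge by (intro mult_le_mono2)
    then show "val e \<le> b + N * G" unfolding val_def by (rule trans_le_add2)
  qed
  obtain F H where FH: "auction r V b G (True # concat (map (\<lambda>_. map (\<lambda>_. True) O') C)) = (F, H)"
    by fastforce
  have ext: "extend r ws C E d P = F @ P"
    using FH by (simp add: extend_def O'_def[symmetric] N_def[symmetric] G_def[symmetric] b_def[symmetric] val_def[symmetric])
  have T: "N * length O' < length (True # concat (map (\<lambda>_. map (\<lambda>_. True) O') C))"
    by (simp add: N_def length_concat o_def sum_list_triv)
  have inv: "invar F H" and final: "bids r V b G F H = []"
    using auction_result[OF T FH] by auto
  have F: "set F \<subseteq> set O'" "distinct (map fst F)" "inj_on (key r) (set F)"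
    using inv by (auto simp: invar_def)
  have F': "set F \<subseteq> set E" "inj_on fst (set F)" "\<And>e. e \<in> set F \<Longrightarrow> fst (fst e) = d"
  proof -
    show "set F \<subseteq> set E" using F(1) O'(1) by blast
    show "inj_on fst (set F)" using F(2) by (simp add: distinct_map)
    show "fst (fst e) = d" if "e \<in> set F" for e using that F(1) O'(2) by blast
  qed
  show "set (extend r ws C E d P) \<subseteq> set E" using F'(1) P(2) by (simp add: ext)
  show "consistent r (set (extend r ws C E d P))"
    unfolding ext set_append using F(1)
    by (intro consistent_Un[OF P(1) F'(1,2) F(3) F'(3)] O'(4)) auto
  assume A: "A \<subseteq> set E" "\<And>e. e \<in> A \<Longrightarrow> fst (fst e) = d \<and> fst e \<notin> fst ` set P" "consistent r (A \<union> set P)"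
  have "A \<subseteq> set O'"
  proof
    fix e assume "e \<in> A"
    with A consistent_subset[OF A(3), of "insert e (set P)"] show "e \<in> set O'"
      by (auto simp: O'_def admissible_def compatible_iff_consistent)
  qed
  moreover have inj: "inj_on fst A" "inj_on (key r) A"
    using consistent_inj_on[OF A(3)] by (auto simp: inj_on_Un)
  ultimately have "(\<Sum>e\<in>A. int (val e) - int b) \<le> (\<Sum>e\<in>set F. int (val e) - int b) + int (length F * G)"
    by (rule auction_near_optimal[OF inv final])
  \<comment> \<open>By additivity, the scaled gains of a set of entries sum to \<open>N\<close>
    times the weight that the set adds to \<open>P\<close>.\<close>
  moreover have "(\<Sum>e\<in>X. int (val e) - int b) = int N * (int (total ws (cover (X \<union> set P))) - int (total ws (cover (set P))))"
    if "X \<subseteq> set E" "inj_on fst X" "\<And>e. e \<in> X \<Longrightarrow> fst (fst e) = d" for X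
    using total_extension[OF _ that, of "set P"]
    by (simp add: val_def b_def list_weight_eq_total sum_distrib_left right_diff_distrib)
  ultimately have "int N * int (total ws (cover (A \<union> set P))) \<le>
      int N * int (total ws (cover (set F \<union> set P))) + int (length F * G)"
    using F' A(1,2) inj(1) by (simp add: right_diff_distrib)
  moreover have "length F * G \<le> n * OPT"
  proof (rule mult_mono[OF _ G_le])
    have "length F = card (fst ` set F)" using F(2) by (metis distinct_card length_map set_map)
    also have "\<dots> \<le> card (fst ` set E)" using F'(1) by (intro card_mono) auto
    finally show "length F \<le> n" using card_slots by linarith
  qed auto
  then have "int (length F * G) \<le> int (n * OPT)" by (rule of_nat_mono)
  ultimately have "int (N * total ws (cover (A \<union> set P))) \<le> int (N * total ws (cover (set F \<union> set P)) + n * OPT)"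
    by simp
  then show "length C * total ws (cover (A \<union> set P)) \<le>
      length C * total ws (cover (set (extend r ws C E d P))) + n * OPT"
    by (simp only: of_nat_le_iff ext set_append N_def)
qed

end

section \<open>Choice of the orientation and of the enumerated entries\<close>

lemma neq_orientation_iff: "d \<noteq> Horizontal \<longleftrightarrow> d = Vertical" "d \<noteq> Vertical \<longleftrightarrow> d = Horizontal"
  by (cases d; simp)+

lemma ex_orientation_iff: "(\<exists>d. P d) \<longleftrightarrow> P Horizontal \<or> P Vertical"
  by (metis neq_orientation_iff(1))

text \<open>Repeatedly take the heaviest remaining element. Among at most n - k elements it carries
  at least the average, so the rest shrinks by the factor (n - k - 1)/(n - k), and these factors
  telescope. Truncated subtraction covers \<open>k > n\<close>.\<close>

lemma exists_heavy_subset: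
  fixes f :: "'a \<Rightarrow> nat"
  assumes "finite B" "card B \<le> n"
  shows "\<exists>K \<subseteq> B. card K \<le> k \<and> card (B - K) \<le> n - k \<and> n * sum f (B - K) \<le> (n - k) * sum f B"
proof (induction k)
  case 0
  then show ?case using assms by (intro exI[of _ "{}"]) simp
next
  case (Suc k)
  then obtain K where K: "K \<subseteq> B" "card K \<le> k" "card (B - K) \<le> n - k"
    "n * sum f (B - K) \<le> (n - k) * sum f B" by blast
  show ?case
  proof (cases "B - K = {}")
    case True
    with K show ?thesis by (intro exI[of _ K]) (simp only: True, simp)
  next
    case False
    obtain x where x: "x \<in> B - K" "\<And>y. y \<in> B - K \<Longrightarrow> f y + 0 \<le> f x + 0"
      using ex_max_nat_diff[of "B - K" f "\<lambda>_. 0"] False assms(1) by auto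
    have fin: "finite (B - K)" using assms(1) by simp
    have "card (B - K) > 0" using False fin by (simp add: card_gt_0_iff)
    then have nk: "n - k > 0" using K(3) by linarith
    have Diff_x: "B - insert x K = B - K - {x}" by auto
    have R: "sum f (B - K) = f x + sum f (B - insert x K)"
      unfolding Diff_x by (rule sum.remove[OF fin x(1)])
    have "sum f (B - K) \<le> card (B - K) * f x"
      using x(2) sum_bounded_above[of "B - K" f "f x"] by simp
    also have "\<dots> \<le> (n - k) * f x" using K(3) by (intro mult_right_mono) auto
    finally have "(n - k) * sum f (B - insert x K) \<le> (n - k - 1) * sum f (B - K)"
      using nk unfolding R by (cases "n - k") (auto simp: algebra_simps)
    then have "n * ((n - k) * sum f (B - insert x K)) \<le> n * ((n - k - 1) * sum f (B - K))"
      by (rule mult_le_mono2)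
    also have "\<dots> = (n - k - 1) * (n * sum f (B - K))" by (simp add: ac_simps)
    also have "\<dots> \<le> (n - k - 1) * ((n - k) * sum f B)" using K(4) by (rule mult_le_mono2)
    finally have "(n - k) * (n * sum f (B - insert x K)) \<le> (n - k) * ((n - Suc k) * sum f B)"
      by (simp add: ac_simps)
    with nk have "n * sum f (B - insert x K) \<le> (n - Suc k) * sum f B"
      using mult_le_cancel1[of "n - k"] by blast
    moreover have "card (B - insert x K) \<le> n - Suc k"
      unfolding Diff_x using K(3) x(1) by (simp add: card_Diff_singleton)
    moreover have "card (insert x K) \<le> Suc k"
      using K(2) finite_subset[OF K(1) assms(1)] by (simp add: card_insert_if)
    ultimately show ?thesis using K(1) x(1) by (intro exI[of _ "insert x K"]) auto
  qed
qed

context crossword_entries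
begin

text \<open>The cells missed by the horizontal entries and those missed by the vertical ones are
  disjoint, so for some \<open>d\<close> the cells missed by orientation \<open>d\<close> weigh at
  most half. \<open>K\<close> consists of up to \<open>k\<close> other entries that recover most of
  this weight.\<close>

lemma exists_start:
  assumes Q: "consistent r Q" "Q \<subseteq> set E"
  obtains K d where "K \<subseteq> {e \<in> Q. fst (fst e) \<noteq> d}" "card K \<le> k"
    "2 * n * total ws (cover Q) \<le>
      2 * n * total ws (cover ({e \<in> Q. fst (fst e) = d} \<union> K)) + (n - k) * total ws (cover Q)"
proof -
  let ?Q = "\<lambda>d. {e \<in> Q. fst (fst e) = d}"
  let ?rest = "\<lambda>d. total ws (cover Q - cover (?Q d))"
  have finQ: "finite Q" using Q(2) finite_subset by blast
  have "e \<in> ?Q Horizontal \<union> ?Q Vertical" if "e \<in> Q" for e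
    using that by (cases "fst (fst e)") simp_all
  then have Q_split: "Q = ?Q Horizontal \<union> ?Q Vertical"  by blast
  have cov_split: "cover Q \<subseteq> cover (?Q Horizontal) \<union> cover (?Q Vertical)"
    using arg_cong[OF Q_split, of cover] unfolding cover_Un by (rule equalityD1)
  have "?rest Horizontal + ?rest Vertical =
      total ws ((cover Q - cover (?Q Horizontal)) \<union> (cover Q - cover (?Q Vertical)))"
    unfolding total_def using finQ cov_split
    by (intro sum.union_disjoint[symmetric]) (auto simp: finite_cover)
  also have "\<dots> \<le> total ws (cover Q)" using finQ by (intro total_mono) (auto simp: finite_cover)
  finally have "2 * ?rest Horizontal \<le> total ws (cover Q) \<or> 2 * ?rest Vertical \<le> total ws (cover Q)"
    by linarith
  then obtain d where d: "2 * ?rest d \<le> total ws (cover Q)" by blast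
  define D where "D = (if d = Horizontal then Vertical else Horizontal)"
  have D: "{e \<in> Q. fst (fst e) \<noteq> d} = ?Q D"
    by (cases d) (simp_all add: D_def neq_orientation_iff)
  \<comment> \<open>What an entry of the other orientation \<open>D\<close> contributes beyond
    orientation \<open>d\<close>; it is additive, since slots of orientation \<open>D\<close> are
    disjoint.\<close>
  let ?f = "\<lambda>e. total ws (set (letters_of e) - cover (?Q d))"
  have inj: "inj_on fst (?Q D)" using consistent_inj_on[OF Q(1)] by (auto intro: inj_on_subset)
  have "card (?Q D) = card (fst ` ?Q D)" using inj by (simp add: card_image)
  also have "\<dots> \<le> card (fst ` set E)" using Q(2) by (intro card_mono) auto
  finally have "card (?Q D) \<le> n" using card_slots by linarith
  from exists_heavy_subset[OF _ this, of k ?f] finQ obtain K where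
    K: "K \<subseteq> ?Q D" "card K \<le> k" "n * sum ?f (?Q D - K) \<le> (n - k) * sum ?f (?Q D)" by auto
  have part: "sum ?f X = total ws (cover X - cover (?Q d))" if "X \<subseteq> ?Q D" for X
    using that Q(2) inj by (intro total_UNION[symmetric, where d = D]) (auto intro: inj_on_subset)
  have cov: "cover Q = cover (?Q d) \<union> cover (?Q D)"
    unfolding cover_Un[symmetric] D[symmetric] by (rule arg_cong[where f = cover]) auto
  have "sum ?f (?Q D) = ?rest d"
    unfolding part[OF order_refl] cov by (rule arg_cong[where f = "total ws"]) auto
  with K(3) d have "2 * (n * sum ?f (?Q D - K)) \<le> (n - k) * total ws (cover Q)"
    using mult_le_mono2[OF d, of "n - k"] by (simp add: algebra_simps)
  moreover have "total ws (cover Q) \<le> total ws (cover (?Q d \<union> K)) + sum ?f (?Q D - K)"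
  proof -
    have "cover Q \<subseteq> cover (?Q d \<union> K) \<union> (cover (?Q D - K) - cover (?Q d))"
      unfolding cov by (auto simp: cover_def)
    then have "total ws (cover Q) \<le> total ws (cover (?Q d \<union> K) \<union> (cover (?Q D - K) - cover (?Q d)))"
      using finQ finite_subset[OF K(1)] by (intro total_mono) (auto simp: finite_cover)
    also have "\<dots> \<le> total ws (cover (?Q d \<union> K)) + total ws (cover (?Q D - K) - cover (?Q d))"
      using finQ finite_subset[OF K(1)]
      by (subst total_Un_Diff) (auto simp: finite_cover intro!: total_mono)
    finally show ?thesis by (simp add: part)
  qed
  then have "2 * n * total ws (cover Q) \<le> 2 * n * (total ws (cover (?Q d \<union> K)) + sum ?f (?Q D - K))"
    by (rule mult_le_mono2)
  ultimately have "2 * n * total ws (cover Q) \<le>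
      2 * n * total ws (cover (?Q d \<union> K)) + (n - k) * total ws (cover Q)"
    by (simp add: algebra_simps)
  with K(1,2) D show thesis by (intro that[of K d]) auto
qed

text \<open>The enumeration meets the set \<open>K\<close> of \<open>exists_start\<close>, and its
  extension by the auction is compared with the entries of \<open>Q\<close> of orientation
  \<open>d\<close>. The losses from the auction and from the dropped entries add up.\<close>

lemma results_props:
  fixes OPT k :: nat and C :: "bool list"
  assumes OPT: "\<And>X. X \<subseteq> set E \<Longrightarrow> consistent r X \<Longrightarrow> total ws (cover X) \<le> OPT"
    and Q: "consistent r Q" "Q \<subseteq> set E" "total ws (cover Q) = OPT"
  defines "R \<equiv> heaviest ws (results r k ws C E)"
  shows "set R \<subseteq> set E" "consistent r (set R)"
    and "2 * n * length C * OPT \<le> 2 * n * length C * total ws (cover (set R)) +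
      2 * n * n * OPT + length C * (n - k) * OPT"
proof -
  have results: "P' \<in> set (results r k ws C E) \<longleftrightarrow>
    (\<exists>P d. compatible r P \<and> length P \<le> k \<and> set P \<subseteq> set E \<and> P' = extend r ws C E d P)" for P'
    by (auto simp: results_def set_lists_upto ex_orientation_iff)
  \<comment> \<open>The empty start guarantees that there is a result at all.\<close>
  have "extend r ws C E Horizontal [] \<in> set (results r k ws C E)"
    unfolding results by (auto simp: compatible_iff_consistent consistent_def cover_def intro!: exI[of _ "[]"])
  then have "results r k ws C E \<noteq> []" by auto
  note heaviest = heaviest_props[OF this, where ws = ws, folded R_def]
  from heaviest(1) obtain P d where "consistent r (set P)" "set P \<subseteq> set E" "R = extend r ws C E d P"
    unfolding results compatible_iff_consistent by blast
  then show "set R \<subseteq> set E" "consistent r (set R)" using extend_props(1,2)[OF _ _ OPT] by blast+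
  obtain K d where K: "K \<subseteq> {e \<in> Q. fst (fst e) \<noteq> d}" "card K \<le> k"
    "2 * n * OPT \<le> 2 * n * total ws (cover ({e \<in> Q. fst (fst e) = d} \<union> K)) + (n - k) * OPT"
    using exists_start[OF Q(1,2), of k] unfolding Q(3) by blast
  let ?A = "{e \<in> Q. fst (fst e) = d}"
  have "K \<subseteq> set E" using K(1) Q(2) by auto
  then have "finite K" by (rule finite_subset) simp
  \<comment> \<open>A list without repetitions, so that its length respects the enumeration bound
    \<open>k\<close>.\<close>
  then obtain P where P: "set P = K" "length P = card K" by (metis distinct_card finite_distinct_list)
  have PE: "set P \<subseteq> set E" and P_cons: "consistent r (set P)"
    using K(1) Q(2) consistent_subset[OF Q(1), of K] by (auto simp: P(1))
  then have "extend r ws C E d P \<in> set (results r k ws C E)"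
    unfolding results compatible_iff_consistent using K(2) P by auto
  from heaviest(2)[OF this] have R: "total ws (cover (set (extend r ws C E d P))) \<le> total ws (cover (set R))"
    by (simp add: list_weight_eq_total)
  have "length C * total ws (cover (?A \<union> K)) \<le>
      length C * total ws (cover (set (extend r ws C E d P))) + n * OPT"
    unfolding P(1)[symmetric]
  proof (rule extend_props(3)[OF P_cons PE OPT])
    show "?A \<subseteq> set E" using Q(2) by auto
    show "fst (fst e) = d \<and> fst e \<notin> fst ` set P" if "e \<in> ?A" for e
    proof
      show "fst (fst e) = d" using that by simp
      \<comment> \<open>The orientation is part of the slot tuple, and \<open>K\<close> has no entry
        of orientation \<open>d\<close>.\<close>
      show "fst e \<notin> fst ` set P"
      proof
        assume "fst e \<in> fst ` set P"
        then obtain f where "f \<in> K" "fst e = fst f" unfolding P(1) by blast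
        with K(1) that show False by auto
      qed
    qed
    show "consistent r (?A \<union> set P)"
      using K(1) by (intro consistent_subset[OF Q(1)]) (auto simp: P(1))
  qed
  also have "\<dots> \<le> length C * total ws (cover (set R)) + n * OPT"
    using R by (intro add_mono mult_le_mono2) auto
  finally have "2 * n * (length C * total ws (cover (?A \<union> K))) \<le> 2 * n * (length C * total ws (cover (set R)) + n * OPT)"
    by (rule mult_le_mono2)
  moreover have "length C * (2 * n * OPT) \<le> length C * (2 * n * total ws (cover (?A \<union> K)) + (n - k) * OPT)"
    using K(3) by (rule mult_le_mono2)
  ultimately show "2 * n * length C * OPT \<le> 2 * n * length C * total ws (cover (set R)) +
      2 * n * n * OPT + length C * (n - k) * OPT"
    by (simp add: algebra_simps)
qed

end

subsection \<open>Crossword instances\<close>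

text \<open>\<open>encode\<close> of this tuple is \<open>enc_slot\<close> of the record.\<close>

definition tuple_of :: "slot \<Rightarrow> slot_tuple" where
  "tuple_of s = (orient s, row s, col s, len s)"

definition entries_of :: "crossword \<Rightarrow> solution \<Rightarrow> entry set" where
  "entries_of I S = {(tuple_of (slots I ! i), u) | i u. i < num_slots I \<and> S ! i = Some u}"

abbreviation instance_entries :: "crossword \<Rightarrow> entry list" where
  "instance_entries I \<equiv> entries (map tuple_of (slots I)) (dict I)"

lemma tuple_of_inject: "tuple_of s = tuple_of t \<longleftrightarrow> s = t"
  by (cases s; cases t) (simp add: tuple_of_def)

lemma fold_next_cell:
  "set (snd (fold (\<lambda>a s. (next_cell d (fst s), (fst s, a) # snd s)) u (p, out))) =
     set out \<union> (\<lambda>k. ((next_cell d ^^ k) p, u ! k)) ` {..<length u}"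
proof (induction u arbitrary: p out)
  case (Cons a u)
  show ?case
    by (simp add: Cons lessThan_Suc_eq_insert_0 image_image funpow_swap1 del: funpow.simps)
       (simp add: funpow_swap1)
qed simp

lemma funpow_next_cell:
  "(next_cell d ^^ k) (i, j) = (if d = Horizontal then (i, j + k) else (i + k, j))"
  by (induction k) (auto simp: next_cell_def)

lemma set_letters_of: "set (letters_of (tuple_of s, u)) = (\<lambda>k. (cell_at s k, u ! k)) ` {..<length u}"
  by (cases "orient s") (simp_all add: letters_of_def fold_next_cell funpow_next_cell tuple_of_def)

lemma lookup_eq_nth: "a < length ws \<Longrightarrow> lookup ws a = ws ! a"
proof -
  have "snd (fold (\<lambda>w s. (fst s + 1, if fst s = a then w else snd s)) ws (i, x)) =
      (if i \<le> a \<and> a < i + length ws then ws ! (a - i) else x)" for i x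
    by (induction ws arbitrary: i x) (auto simp: nth_Cons' Suc_diff_Suc)
  then show "a < length ws \<Longrightarrow> lookup ws a = ws ! a" by (simp add: lookup_def)
qed

lemma set_entries: "e \<in> set (entries ss D) \<longleftrightarrow>
    fst e \<in> set ss \<and> snd e \<in> set D \<and> length (snd e) = snd (snd (snd (fst e)))"
  by (cases e) (auto simp: entries_def)

lemma fst_letters_of:
  assumes "e \<in> set (entries ss D)" "fst e = tuple_of s"
  shows "fst ` set (letters_of e) = cells s"
proof -
  obtain u where u: "e = (tuple_of s, u)" using assms(2) by (cases e) simp
  then have "length u = len s" using assms(1) by (simp add: set_entries tuple_of_def)
  then show ?thesis by (simp add: u set_letters_of cells_def image_image del: cell_at.simps)
qed

lemma cells_disjoint:
  "crossword_over A I \<Longrightarrow> i < num_slots I \<Longrightarrow> j < num_slots I \<Longrightarrow> i \<noteq> j \<Longrightarrow>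
     orient (slots I ! i) = orient (slots I ! j) \<Longrightarrow> cells (slots I ! i) \<inter> cells (slots I ! j) = {}"
  unfolding crossword_over_def by blast

text \<open>A slot listed twice would be disjoint from itself, yet every slot has a cell.\<close>

lemma distinct_slots:
  assumes "crossword_over A I" shows "distinct (slots I)"
  unfolding distinct_conv_nth
proof (intro allI impI notI)
  fix i j assume ij: "i < num_slots I" "j < num_slots I" "i \<noteq> j" "slots I ! i = slots I ! j"
  then have "cells (slots I ! i) = {}" using cells_disjoint[OF assms ij(1-3)] by simp
  moreover have "len (slots I ! i) > 0"
    using assms ij(1) unfolding crossword_over_def by auto
  ultimately show False by (auto simp: cells_def)
qed

lemma crossword_entries:
  assumes "crossword_over A I"
  shows "crossword_entries (instance_entries I) (num_slots I)"
proof
  fix e f assume ef: "e \<in> set (instance_entries I)" "f \<in> set (instance_entries I)" "fst e \<noteq> fst f"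
    "fst (fst e) = fst (fst f)"
  obtain s t where st: "fst e = tuple_of s" "s \<in> set (slots I)" "fst f = tuple_of t" "t \<in> set (slots I)"
    using ef(1,2) by (auto simp: set_entries)
  then obtain i j where ij: "i < num_slots I" "slots I ! i = s" "j < num_slots I" "slots I ! j = t"
    by (auto simp: in_set_conv_nth)
  have "orient s = orient t" using ef(4) st by (simp add: tuple_of_def)
  moreover have "i \<noteq> j" using ef(3) st ij by auto
  ultimately have "cells s \<inter> cells t = {}" using cells_disjoint[OF assms, of i j] ij by simp
  moreover have "fst ` set (letters_of e) = cells s" "fst ` set (letters_of f) = cells t"
    using fst_letters_of ef(1,2) st(1,3) by blast+
  ultimately show "fst ` set (letters_of e) \<inter> fst ` set (letters_of f) = {}" by simp
next
  have "fst ` set (instance_entries I) \<subseteq> set (map tuple_of (slots I))" by (auto simp: set_entries)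
  then have "card (fst ` set (instance_entries I)) \<le> card (set (map tuple_of (slots I)))"
    by (intro card_mono) auto
  also have "\<dots> \<le> num_slots I" using card_length[of "map tuple_of (slots I)"] by simp
  finally show "card (fst ` set (instance_entries I)) \<le> num_slots I" .
qed

lemma entries_of_subset_iff:
  "entries_of I S \<subseteq> set (instance_entries I) \<longleftrightarrow>
     (\<forall>i < num_slots I. \<forall>u. S ! i = Some u \<longrightarrow> u \<in> set (dict I) \<and> length u = len (slots I ! i))"
proof -
  have "entries_of I S \<subseteq> set (instance_entries I) \<longleftrightarrow>
      (\<forall>i < num_slots I. \<forall>u. S ! i = Some u \<longrightarrow> (tuple_of (slots I ! i), u) \<in> set (instance_entries I))"
    unfolding entries_of_def by blast
  moreover have "(tuple_of (slots I ! i), u) \<in> set (instance_entries I) \<longleftrightarrow>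
      u \<in> set (dict I) \<and> length u = len (slots I ! i)" if "i < num_slots I" for i u
    using that by (simp add: set_entries) (simp add: tuple_of_def)
  ultimately show ?thesis by simp
qed

lemma placed_eq_cover:
  assumes "entries_of I S \<subseteq> set (instance_entries I)"
  shows "placed I S = cover (entries_of I S)"
proof -
  have "placed I S = (\<Union>i \<in> {..<num_slots I}. \<Union>u \<in> {u. S ! i = Some u}.
      (\<lambda>k. (cell_at (slots I ! i) k, u ! k)) ` {..<len (slots I ! i)})"
    by (auto simp: placed_def)
  \<comment> \<open>Each word has the length of its slot, so the two index ranges agree.\<close>
  also have "\<dots> = (\<Union>i \<in> {..<num_slots I}. \<Union>u \<in> {u. S ! i = Some u}.
      set (letters_of (tuple_of (slots I ! i), u)))"
    using assms by (intro SUP_cong refl) (auto simp: entries_of_subset_iff set_letters_of)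
  also have "\<dots> = cover (entries_of I S)" by (auto simp: cover_def entries_of_def)
  finally show ?thesis .
qed

lemma functional_iff:
  "(\<forall>c a b. (c, a) \<in> L \<and> (c, b) \<in> L \<longrightarrow> a = b) \<longleftrightarrow> (\<forall>p \<in> L. \<forall>q \<in> L. fst p = fst q \<longrightarrow> p = q)"
  by fastforce

text \<open>One word per slot is automatic, as slots are distinct and each has one position in
  \<open>S\<close>. One entry per key is the ban on reuse; with reuse the key contains the slot and
  nothing is forbidden.\<close>

lemma feasible_iff:
  assumes I: "crossword_over A I" and S: "length S = num_slots I"
  shows "feasible r I S \<longleftrightarrow> entries_of I S \<subseteq> set (instance_entries I) \<and> consistent r (entries_of I S)"
proof (cases "entries_of I S \<subseteq> set (instance_entries I)")
  case True
  have inj: "i = j" if "i < num_slots I" "j < num_slots I" "tuple_of (slots I ! i) = tuple_of (slots I ! j)" for i j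
    using that distinct_slots[OF I] by (simp add: tuple_of_inject nth_eq_iff_index_eq)
  have "(\<forall>e \<in> entries_of I S. \<forall>f \<in> entries_of I S. fst e = fst f \<or> key r e = key r f \<longrightarrow> e = f) \<longleftrightarrow>
    (\<not> r \<longrightarrow> (\<forall>i < num_slots I. \<forall>j < num_slots I. \<forall>u. S ! i = Some u \<and> S ! j = Some u \<longrightarrow> i = j))"
    (is "?L \<longleftrightarrow> ?R")
  proof
    assume ?L
    show ?R
    proof (intro impI allI)
      fix i j u assume *: "\<not> r" "i < num_slots I" "j < num_slots I" "S ! i = Some u \<and> S ! j = Some u"
      then have "(tuple_of (slots I ! i), u) \<in> entries_of I S" "(tuple_of (slots I ! j), u) \<in> entries_of I S"
        by (auto simp: entries_of_def)
      with \<open>?L\<close> *(1) have "tuple_of (slots I ! i) = tuple_of (slots I ! j)" by (force simp: key_def)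
      with inj * show "i = j" by blast
    qed
  next
    assume ?R
    show ?L
    proof (intro ballI impI)
      fix e f assume ef: "e \<in> entries_of I S" "f \<in> entries_of I S" "fst e = fst f \<or> key r e = key r f"
      then obtain i j u v where *: "e = (tuple_of (slots I ! i), u)" "f = (tuple_of (slots I ! j), v)"
        "i < num_slots I" "j < num_slots I" "S ! i = Some u" "S ! j = Some v"
        by (auto simp: entries_of_def)
      have "i = j"
        using ef(3)
      proof
        assume "fst e = fst f"
        with inj * show ?thesis by simp
      next
        assume "key r e = key r f"
        then show ?thesis using inj * \<open>?R\<close> by (cases r) (simp_all add: key_def)
      qed
      with * show "e = f" by simp
    qed
  qed
  then have "consistent r (entries_of I S) \<longleftrightarrow>
      (\<forall>c a b. (c, a) \<in> placed I S \<and> (c, b) \<in> placed I S \<longrightarrow> a = b) \<and>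
      (\<not> r \<longrightarrow> (\<forall>i < num_slots I. \<forall>j < num_slots I. \<forall>u. S ! i = Some u \<and> S ! j = Some u \<longrightarrow> i = j))"
    by (simp only: consistent_def placed_eq_cover[OF True] functional_iff)
  with True S show ?thesis unfolding feasible_def entries_of_subset_iff by blast
next
  case False
  then show ?thesis unfolding feasible_def entries_of_subset_iff by blast
qed

text \<open>Letters of dictionary words lie below \<open>A\<close>, where \<open>lookup\<close> is
  list access.\<close>

lemma weight_eq_total:
  assumes I: "crossword_over A I" and S: "entries_of I S \<subseteq> set (instance_entries I)"
  shows "weight I S = total (letter_weight I) (cover (entries_of I S))"
  unfolding weight_def placed_eq_cover[OF S] total_def case_prod_unfold
proof (rule sum.cong[OF refl])
  fix p assume "p \<in> cover (entries_of I S)"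
  then obtain e where "e \<in> entries_of I S" and p: "p \<in> set (letters_of e)" by (auto simp: cover_def)
  with S have e: "e \<in> set (instance_entries I)" by blast
  then obtain s where s: "fst e = tuple_of s" by (auto simp: set_entries)
  with p set_letters_of[of s "snd e"] have "snd p \<in> set (snd e)" by (cases e) auto
  moreover have "set (snd e) \<subseteq> {..<A}" "length (letter_weight I) = A"
    using I e by (auto simp: crossword_over_def set_entries)
  ultimately show "letter_weight I ! snd p = lookup (letter_weight I) (snd p)"
    by (subst lookup_eq_nth) auto
qed

text \<open>By consistency each slot occurs in at most one entry of \<open>R\<close>, so reading
  \<open>R\<close> slot by slot loses nothing.\<close>

lemma entries_of_word_at:
  assumes "consistent r (set R)" "set R \<subseteq> set (instance_entries I)"
  shows "entries_of I (map (word_at R) (map tuple_of (slots I))) = set R"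
proof -
  have word_at: "word_at R s = Some u \<longleftrightarrow> (s, u) \<in> set R" for s u
  proof (cases "filter (\<lambda>e. fst e = s) R")
    case Nil
    then show ?thesis by (auto simp: word_at_def filter_empty_conv)
  next
    case (Cons e es)
    then have "e \<in> set (filter (\<lambda>e. fst e = s) R)" by simp
    then have e: "e \<in> set R" "fst e = s" by auto
    then have same: "f = e" if "f \<in> set R" "fst f = s" for f
      using assms(1) that unfolding consistent_def by blast
    have "(s, u) \<in> set R \<longleftrightarrow> u = snd e"
    proof
      assume "(s, u) \<in> set R"
      with same[of "(s, u)"] show "u = snd e" by force
    next
      assume "u = snd e"
      with e show "(s, u) \<in> set R" by (metis prod.collapse)
    qed
    then show ?thesis by (auto simp: word_at_def Cons)
  qed
  show ?thesis
  proof (intro equalityI subsetI)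
    fix e assume "e \<in> entries_of I (map (word_at R) (map tuple_of (slots I)))"
    then obtain i u where "e = (tuple_of (slots I ! i), u)" "i < num_slots I"
      "map (word_at R) (map tuple_of (slots I)) ! i = Some u"
      unfolding entries_of_def by blast
    then show "e \<in> set R" by (simp add: word_at)
  next
    fix e assume e: "e \<in> set R"
    with assms(2) have "e \<in> set (instance_entries I)" by blast
    then have "fst e \<in> set (map tuple_of (slots I))" unfolding set_entries by blast
    then obtain i where i: "i < num_slots I" "fst e = tuple_of (slots I ! i)" by (auto simp: in_set_conv_nth)
    with e have "word_at R (tuple_of (slots I ! i)) = Some (snd e)" unfolding word_at by (metis prod.collapse)
    then have "map (word_at R) (map tuple_of (slots I)) ! i = Some (snd e)" using i(1) by simp
    moreover have "e = (tuple_of (slots I ! i), snd e)" using i(2) by (metis prod.collapse)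
    ultimately show "e \<in> entries_of I (map (word_at R) (map tuple_of (slots I)))"
      unfolding entries_of_def using i(1) by blast
  qed
qed

text \<open>A consistent set, listed and read slot by slot, is a feasible solution of the same
  weight.\<close>

lemma crossword_total_le:
  assumes I: "crossword_over A I" and X: "X \<subseteq> set (instance_entries I)" "consistent r X"
  shows "total (letter_weight I) (cover X) \<le> opt_weight r I"
proof -
  obtain R where R: "set R = X" using X(1) finite_list finite_subset by (metis finite_set)
  let ?S = "map (word_at R) (map tuple_of (slots I))"
  have S: "entries_of I ?S = X" using X R by (metis entries_of_word_at)
  have "feasible r I ?S" using X by (subst feasible_iff[OF I]) (simp_all only: S, simp_all)
  moreover have "weight I ?S = total (letter_weight I) (cover X)"
    using weight_eq_total[OF I, of ?S] X(1) unfolding S by blast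
  ultimately show ?thesis
    unfolding opt_weight_def by (metis Max_ge finite_feasible finite_imageI imageI mem_Collect_eq)
qed

section \<open>The approximation ratio\<close>

lemma ratio_bound:
  fixes \<epsilon> :: real and n k w opt :: nat
  assumes \<epsilon>: "0 < \<epsilon>" "\<epsilon> \<le> 1" and n: "0 < n" and k: "4 / \<epsilon> \<le> real k"
    and le: "2 * n * (k * n * n) * opt \<le> 2 * n * (k * n * n) * w + 2 * n * n * opt + (k * n * n) * (n - k) * opt"
  shows "(1 / 2 + 1 / (2 * (\<epsilon> * real n + 1))) * real opt \<le> real w"
proof -
  define m where "m = n - k"
  define x where "x = 1 / (2 * (\<epsilon> * real n + 1))"
  have "4 \<le> 4 / \<epsilon>" using \<epsilon> by (simp add: field_simps)
  with k have k4: "4 \<le> real k" by linarith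
  with n have pos: "real n \<ge> 1" "real k > 0" by auto
  have "real (2 * n * (k * n * n) * opt) \<le> real (2 * n * (k * n * n) * w + 2 * n * n * opt + (k * n * n) * m * opt)"
    using le unfolding m_def by (rule of_nat_mono)
  then have "(real n)\<^sup>2 * (2 * n * k * opt) \<le> (real n)\<^sup>2 * (2 * n * k * w + 2 * opt + k * real m * opt)"
    by (simp add: algebra_simps power2_eq_square)
  \<comment> \<open>Relative to \<open>2 * n * k\<close>, the auction costs \<open>2 * opt\<close>
    and the dropped entries cost \<open>k * m * opt\<close>.\<close>
  then have main: "2 * n * k * opt \<le> 2 * n * k * w + 2 * opt + k * real m * opt"
    using pos by (simp add: mult_le_cancel_left_pos)
  have key: "2 * n * k * (1 / 2 + x) + 2 + k * real m \<le> 2 * real n * k"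
  proof (cases "k \<le> n")
    \<comment> \<open>The claim amounts to \<open>2 * n * k * x + 2 \<le> k * k\<close>; the two
      summands are at most a quarter and a half of the right-hand side.\<close>
    case True
    have "0 < 2 + \<epsilon> * (real n * 2)" using \<epsilon> by (intro add_pos_nonneg) auto
    then have "2 * n * x \<le> 1 / \<epsilon>" using \<epsilon> by (simp add: x_def field_simps)
    also have "\<dots> \<le> k / 4" using k by simp
    finally have "k * (2 * n * x) \<le> k * (k / 4)" by (intro mult_left_mono) auto
    moreover have "2 \<le> k * (real k / 2)" using mult_mono[OF k4 k4] by simp
    ultimately show ?thesis using True by (simp add: m_def of_nat_diff algebra_simps)
  next
    \<comment> \<open>Now \<open>m = 0\<close>, and the claim amounts to
      \<open>2 \<le> n * k * (1 - 2 * x)\<close>. It follows from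
      \<open>4 \<le> k * \<epsilon>\<close> and \<open>\<epsilon> + 1 \<le> 2\<close>.\<close>
    case False
    have "2 * (1 / (2 * y)) = 1 / y" for y :: real by simp
    then have "2 * x = 1 / (\<epsilon> * n + 1)" unfolding x_def .
    also have "\<dots> \<le> 1 / (\<epsilon> + 1)" using \<epsilon> pos by (intro divide_left_mono mult_pos_pos add_nonneg_pos) auto
    finally have x: "\<epsilon> / (\<epsilon> + 1) \<le> 1 - 2 * x" using \<epsilon> by (simp add: field_simps)
    have "2 \<le> 4 / (\<epsilon> + 1)" using \<epsilon> by (simp add: field_simps)
    also have "4 \<le> k * \<epsilon>" using k \<epsilon> by (simp add: field_simps)
    then have "4 / (\<epsilon> + 1) \<le> k * (\<epsilon> / (\<epsilon> + 1))"
      using \<epsilon> divide_right_mono[of 4 "k * \<epsilon>" "\<epsilon> + 1"] by simp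
    also have "\<dots> \<le> (n * k) * (1 - 2 * x)" using x \<epsilon> pos by (intro mult_mono) auto
    finally show ?thesis using False by (simp add: m_def algebra_simps)
  qed
  have "(2 * n * k * (1 / 2 + x) + 2 + k * real m) * opt \<le> 2 * real n * k * opt"
    using key by (intro mult_right_mono) auto
  with main have "(2 * real n * k) * ((1 / 2 + x) * opt) \<le> (2 * real n * k) * w"
    by (simp add: algebra_simps)
  with pos show ?thesis unfolding x_def by (simp add: mult_le_cancel_left_pos)
qed

lemma solve_correct:
  fixes \<epsilon> :: real and k A :: nat and r :: bool and I :: crossword
  assumes \<epsilon>: "0 < \<epsilon>" "\<epsilon> \<le> 1" and k: "4 / \<epsilon> \<le> real k" and I: "crossword_over A I"
  defines "S \<equiv> solve r k (map tuple_of (slots I)) (dict I) (letter_weight I)"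
  shows "feasible r I S"
    and "(1 / 2 + 1 / (2 * (\<epsilon> * real (num_slots I) + 1))) * real (opt_weight r I) \<le> real (weight I S)"
proof -
  let ?n = "num_slots I"
  interpret crossword_entries r "letter_weight I" "instance_entries I" ?n
    using crossword_entries[OF I] by blast
  define C where "C = concat (map (\<lambda>_. concat (map (\<lambda>_. replicate k True) (map tuple_of (slots I)))) (map tuple_of (slots I)))"
  define R where "R = heaviest (letter_weight I) (results r k (letter_weight I) C (instance_entries I))"
  have S: "S = map (word_at R) (map tuple_of (slots I))"
    by (simp only: S_def solve_def best_entries_def R_def C_def)
  have C: "length C = k * ?n * ?n"
    by (simp add: C_def length_concat o_def sum_list_triv)
  have "Max (weight I ` {S. feasible r I S}) \<in> weight I ` {S. feasible r I S}"
    using feasible_empty by (intro Max_in) (auto simp: finite_feasible)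
  then obtain S0 where S0: "feasible r I S0" "weight I S0 = opt_weight r I"
    by (auto simp: opt_weight_def)
  then have Q: "entries_of I S0 \<subseteq> set (instance_entries I)" "consistent r (entries_of I S0)"
    using feasible_iff[OF I, of S0 r] by (auto simp: feasible_def)
  have opt: "total (letter_weight I) (cover (entries_of I S0)) = opt_weight r I"
    using weight_eq_total[OF I Q(1)] S0(2) by simp
  note props = results_props[OF crossword_total_le[OF I] Q(2,1) opt, where k = k and C = C, folded R_def]
  have R: "set R \<subseteq> set (instance_entries I)" "consistent r (set R)" using props(1,2) by blast+
  have ent: "entries_of I S = set R" unfolding S by (rule entries_of_word_at[OF R(2,1)])
  show "feasible r I S"
    using R by (subst feasible_iff[OF I]) (simp_all only: ent, simp_all add: S)
  have w: "weight I S = total (letter_weight I) (cover (set R))"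
    using weight_eq_total[OF I, of S] R(1) by (simp add: ent)
  show "(1 / 2 + 1 / (2 * (\<epsilon> * real ?n + 1))) * real (opt_weight r I) \<le> real (weight I S)"
  proof (cases "?n = 0")
    \<comment> \<open>Without slots nothing is placed and the optimum is 0; the scaled inequality is
      void here.\<close>
    case True
    then have "weight I S0 = 0" by (simp add: weight_def placed_def)
    with S0(2) show ?thesis by simp
  next
    case False
    with props(3) show ?thesis
      unfolding w C by (intro ratio_bound[OF \<epsilon> _ k]) auto
  qed
qed

section \<open>Agreement of the encodings and conclusion\<close>

lemma enc_crossword_eq_encode:
  "enc_crossword I = encode (height I, width I, map tuple_of (slots I), dict I, letter_weight I)"
proof -
  have "enc_list enc_slot xs = encode (map tuple_of xs)" for xs
    by (induction xs) (simp_all add: enc_list_def enc_slot_def tuple_of_def encode_nat_def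
        encode_orientation_def encode_prod_def)
  then show ?thesis by (simp add: enc_crossword_def encode_list_def encode_nat_def)
qed

lemma enc_solution_eq_encode: "enc_solution S = encode S"
proof -
  have "(encode :: word \<Rightarrow> tree) = enc_list enc_nat" by (simp add: encode_list_def encode_nat_def)
  then show ?thesis by (simp add: enc_solution_def encode_list_def encode_option_def)
qed

theorem theorem20:
  fixes \<epsilon> :: real and A :: nat and reuse :: bool
  assumes "0 < \<epsilon>" and "\<epsilon> \<le> 1"
  shows "poly_time_approximable A reuse (\<lambda>n. 1 / 2 + 1 / (2 * (\<epsilon> * real n + 1)))"
proof -
  \<comment> \<open>\<open>k\<close> depends on \<open>\<epsilon>\<close> alone, so enumerating up
    to \<open>k\<close> entries stays polynomial; \<open>4 / \<epsilon>\<close> is the threshold of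
    \<open>ratio_bound\<close>.\<close>
  obtain k where k: "4 / \<epsilon> \<le> real k" using real_arch_simple by blast
  have "ptime (\<lambda>x :: nat \<times> nat \<times> slot_tuple list \<times> word list \<times> nat list.
      solve reuse k (fst (snd (snd x))) (fst (snd (snd (snd x)))) (snd (snd (snd (snd x)))))"
    by (intro ptime_solve ptime_intros)
  then obtain p q where pq: "\<And>x :: nat \<times> nat \<times> slot_tuple list \<times> word list \<times> nat list.
      \<exists>t. exec p (encode x) t (encode (solve reuse k (fst (snd (snd x)))
        (fst (snd (snd (snd x)))) (snd (snd (snd (snd x)))))) \<and> t \<le> poly q (tsize x)"
    by (rule ptimeE) blast
  show ?thesis
    unfolding poly_time_approximable_def
  proof (intro exI[of _ p] exI[of _ q] allI impI)
    fix I assume I: "crossword_over A I"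
    let ?S = "solve reuse k (map tuple_of (slots I)) (dict I) (letter_weight I)"
    obtain t where "exec p (enc_crossword I) t (enc_solution ?S)" "t \<le> poly q (size (enc_crossword I))"
      using pq[of "(height I, width I, map tuple_of (slots I), dict I, letter_weight I)"]
      unfolding enc_crossword_eq_encode enc_solution_eq_encode by auto
    with solve_correct[OF assms k I] show "\<exists>t S. exec p (enc_crossword I) t (enc_solution S) \<and>
        t \<le> poly q (size (enc_crossword I)) \<and> feasible reuse I S \<and>
        (1 / 2 + 1 / (2 * (\<epsilon> * real (num_slots I) + 1))) * real (opt_weight reuse I) \<le> real (weight I S)"
      by blast
  qed
qed

end
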